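(* Let $\Gamma$ be a word-hyperbolic group and let $\mathcal{A}\Gamma$ be an unconditional admissible Fréchet algebra over $\mathbb{C}\Gamma$. Let $\mathcal{A}_\omega\Gamma=\bigcup_n\mathcal{A}_n\Gamma$ be its canonical bornological subalgebra. Let $\chi_{\langle x\rangle}$ be the characteristic function of a conjugacy class $\langle x\rangle$ of $\Gamma$. Then pointwise multiplication with $\chi_{\langle x\rangle}$ gives rise to a bounded linear operator $$m_{\langle x\rangle}:\mathcal{A}_\omega\Gamma\to\ell^1(\Gamma).$$
   Context: For a set $X$, $\mathbb{C}X$ is the complex vector space with basis $(u_x)_{x\in X}$; for $a=\sum a_xu_x$ put $|a|=\sum|a_x|u_x$, and write $|a|\le|b|$ if $|a_x|\le|b_x|$ for all $x$. A seminorm on $\mathbb{C}X$ is unconditional if $|a|\le|b|$ implies $\|a\|\le\|b\|$. $\mathbb{C}\Gamma$ is the group ring. An unconditional Banach (Fréchet) algebra over $\mathbb{C}\Gamma$ is a Banach (Fréchet) algebra obtained from $\mathbb{C}\Gamma$ by completion with respect to a (countable) family of unconditional seminorms; it contains $\mathbb{C}\Gamma$ as a dense subalgebra. A Fréchet algebra $A$ is admissible if there is an open neighbourhood $U$ of $0$ (called an open unit ball) such that for every compact $K\subset U$ the union $\bigcup_{n\ge1}K^n$ is relatively compact in $A$. The algebras $\mathcal{A}_n\Gamma$: fix a finite symmetric generating set $S$ of $\Gamma$ with word length $l_S$ and an open unit ball $U\subset\mathcal{A}\Gamma$ stable under $a\mapsto|a|$. For $n\ge1$ put $T_n=\big(\sum_{l_S(g)\le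 n}\mathbb{C}u_g\big)\cap\frac{n}{n+1}U$. Let $\|\cdot\|_n$ be the largest unconditional submultiplicative seminorm on $\mathbb{C}\Gamma$ with $\|t\|_n\le1$ for all $t\in T_n$, and $\mathcal{A}_n\Gamma$ the completion of $\mathbb{C}\Gamma$ with respect to $\|\cdot\|_n$. For $n<m$ the identity of $\mathbb{C}\Gamma$ extends to a bounded homomorphism $\mathcal{A}_n\Gamma\to\mathcal{A}_m\Gamma$. $\mathcal{A}_\omega\Gamma=\bigcup_n\mathcal{A}_n\Gamma$ is a bornological algebra (a set is bounded if it is contained and bounded in some $\mathcal{A}_n\Gamma$), independent of the choices of $S$ and $U$; an operator on it is bounded if its restriction to every $\mathcal{A}_n\Gamma$ is bounded. On $\mathbb{C}\Gamma$, pointwise multiplication by $\chi_{\langle x\rangle}$ sends $\sum_ga_gu_g$ to $\sum_{g\in\langle x\rangle}a_gu_g$. *)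

theory Defs
  imports "HOL-Analysis.Analysis" "HOL-Library.Poly_Mapping" "HOL-Library.Set_Algebras"
begin

text \<open>
  The group \<open>\<Gamma>\<close> is a type \<open>'g\<close> of class \<^class>\<open>group_add\<close> (not assumed commutative), so that
  \<open>'g \<Rightarrow>\<^sub>0 complex\<close> with the convolution product of \<^theory>\<open>HOL-Library.Poly_Mapping\<close> is its complex
  group ring: \<open>u\<^sub>g u\<^sub>h = u\<^bsub>g + h\<^esub>\<close>, with unit \<open>u\<^sub>0\<close>.
\<close>

definition fin_sym_generating_set :: "'g::group_add set \<Rightarrow> bool" where
  "fin_sym_generating_set S \<longleftrightarrow>
     finite S \<and> uminus ` S = S \<and> (\<forall>g. \<exists>ws. set ws \<subseteq> S \<and> sum_list ws = g)"

definition word_length :: "'g::group_add set \<Rightarrow> 'g \<Rightarrow> nat" where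
  "word_length S g = (LEAST n. \<exists>ws. length ws = n \<and> set ws \<subseteq> S \<and> sum_list ws = g)"

definition word_metric :: "'g::group_add set \<Rightarrow> 'g \<Rightarrow> 'g \<Rightarrow> real" where
  "word_metric S g h = real (word_length S (- g + h))"

text \<open>Gromov's four-point condition, imposed on the vertices of the Cayley graph.\<close>

definition gromov_product :: "('x \<Rightarrow> 'x \<Rightarrow> real) \<Rightarrow> 'x \<Rightarrow> 'x \<Rightarrow> 'x \<Rightarrow> real" where
  "gromov_product d w y z = (d w y + d w z - d y z) / 2"

definition gromov_hyperbolic :: "('x \<Rightarrow> 'x \<Rightarrow> real) \<Rightarrow> bool" where
  "gromov_hyperbolic d \<longleftrightarrow>
     (\<exists>\<delta>\<ge>0. \<forall>w x y z.
        gromov_product d w x z \<ge> min (gromov_product d w x y) (gromov_product d w y z) - \<delta>)"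

definition word_hyperbolic :: "'g::group_add itself \<Rightarrow> bool" where
  "word_hyperbolic _ \<longleftrightarrow>
     (\<exists>S :: 'g set. fin_sym_generating_set S \<and> gromov_hyperbolic (word_metric S))"

definition conjugacy_class :: "'g::group_add \<Rightarrow> 'g set" where
  "conjugacy_class x = {h + x - h | h. True}"

definition gr_scale :: "complex \<Rightarrow> ('g \<Rightarrow>\<^sub>0 complex) \<Rightarrow> ('g \<Rightarrow>\<^sub>0 complex)" where
  "gr_scale c a = Poly_Mapping.map (\<lambda>z. c * z) a"

definition gr_abs :: "('g \<Rightarrow>\<^sub>0 complex) \<Rightarrow> ('g \<Rightarrow>\<^sub>0 complex)" where
  "gr_abs a = Poly_Mapping.map (\<lambda>z. complex_of_real (cmod z)) a"

definition seminorm :: "(complex \<Rightarrow> 'v \<Rightarrow> 'v) \<Rightarrow> ('v::ab_group_add \<Rightarrow> real) \<Rightarrow> bool" where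
  "seminorm scaleC N \<longleftrightarrow>
     (\<forall>a. 0 \<le> N a) \<and> (\<forall>a b. N (a + b) \<le> N a + N b) \<and> (\<forall>c a. N (scaleC c a) = cmod c * N a)"

definition unconditional :: "(('g \<Rightarrow>\<^sub>0 complex) \<Rightarrow> real) \<Rightarrow> bool" where
  "unconditional N \<longleftrightarrow>
     (\<forall>a b. (\<forall>g. cmod (Poly_Mapping.lookup a g) \<le> cmod (Poly_Mapping.lookup b g)) \<longrightarrow> N a \<le> N b)"

definition submultiplicative :: "('v::times \<Rightarrow> real) \<Rightarrow> bool" where
  "submultiplicative N \<longleftrightarrow> (\<forall>a b. N (a * b) \<le> N a * N b)"

text \<open>
  A Frechet algebra is a complete Hausdorff locally convex complex algebra whose topology is given by
  countably many seminorms and whose multiplication is jointly continuous; it need not be locally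
  multiplicatively convex. Scalar multiplication by complex numbers is an explicit parameter.
\<close>

definition complex_algebra :: "(complex \<Rightarrow> 'a::ring_1 \<Rightarrow> 'a) \<Rightarrow> bool" where
  "complex_algebra scaleC \<longleftrightarrow>
     vector_space scaleC \<and>
     (\<forall>c a b. scaleC c a * b = scaleC c (a * b) \<and> a * scaleC c b = scaleC c (a * b))"

definition topology_given_by :: "(nat \<Rightarrow> 'a::{ab_group_add,topological_space} \<Rightarrow> real) \<Rightarrow> bool" where
  "topology_given_by q \<longleftrightarrow>
     (\<forall>W. open W \<longleftrightarrow>
        (\<forall>a\<in>W. \<exists>F \<epsilon>. finite F \<and> \<epsilon> > 0 \<and> {b. \<forall>k\<in>F. q k (b - a) < \<epsilon>} \<subseteq> W))"

definition sequentially_complete :: "'a::{ab_group_add,topological_space} itself \<Rightarrow> bool" where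
  "sequentially_complete _ \<longleftrightarrow>
     (\<forall>f :: nat \<Rightarrow> 'a.
        (\<forall>W. open W \<and> 0 \<in> W \<longrightarrow> (\<exists>M. \<forall>i\<ge>M. \<forall>j\<ge>M. f i - f j \<in> W)) \<longrightarrow>
        (\<exists>a. f \<longlonglongrightarrow> a))"

definition frechet_algebra :: "(complex \<Rightarrow> 'a::{ring_1,t2_space} \<Rightarrow> 'a) \<Rightarrow> bool" where
  "frechet_algebra scaleC \<longleftrightarrow>
     complex_algebra scaleC \<and>
     (\<exists>q. (\<forall>k. seminorm scaleC (q k)) \<and> topology_given_by q) \<and>
     sequentially_complete TYPE('a) \<and>
     continuous_on UNIV (\<lambda>(a :: 'a, b). a * b)"

text \<open>
  A completion of the group ring is a Frechet algebra together with the inclusion \<open>\<iota>\<close> of the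
  group ring: the image is dense, and the topology is given by (the continuous extensions \<open>q k\<close> of)
  unconditional seminorms \<open>q k \<circ> \<iota>\<close>. Assuming the algebra and \<open>\<iota>\<close> to be unital is no restriction,
  as \<open>\<iota> 1\<close> is a unit by density.
\<close>

definition unconditional_frechet_algebra ::
  "(complex \<Rightarrow> 'a::{ring_1,t2_space} \<Rightarrow> 'a) \<Rightarrow> (('g::group_add \<Rightarrow>\<^sub>0 complex) \<Rightarrow> 'a) \<Rightarrow> bool" where
  "unconditional_frechet_algebra scaleC \<iota> \<longleftrightarrow>
     frechet_algebra scaleC \<and>
     Vector_Spaces.linear gr_scale scaleC \<iota> \<and> (\<forall>a b. \<iota> (a * b) = \<iota> a * \<iota> b) \<and> \<iota> 1 = 1 \<and>
     inj \<iota> \<and> closure (range \<iota>) = UNIV \<and>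
     (\<exists>q. (\<forall>k. seminorm scaleC (q k) \<and> unconditional (q k \<circ> \<iota>)) \<and> topology_given_by q)"

text \<open>The powers \<open>K ^ n\<close> are those of \<^theory>\<open>HOL-Library.Set_Algebras\<close>: sets of \<open>n\<close>-fold products.\<close>

definition open_unit_ball :: "'a::{ring_1,t2_space} set \<Rightarrow> bool" where
  "open_unit_ball U \<longleftrightarrow>
     open U \<and> 0 \<in> U \<and>
     (\<forall>K. compact K \<and> K \<subseteq> U \<longrightarrow> compact (closure (\<Union>n\<in>{1::nat..}. K ^ n)))"

definition admissible :: "'a::{ring_1,t2_space} itself \<Rightarrow> bool" where
  "admissible _ \<longleftrightarrow> (\<exists>U :: 'a set. open_unit_ball U)"

definition cauchy_seqs :: "('v::ab_group_add \<Rightarrow> real) \<Rightarrow> (nat \<Rightarrow> 'v) set" where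
  "cauchy_seqs N = {f. \<forall>\<epsilon>>0. \<exists>M. \<forall>i\<ge>M. \<forall>j\<ge>M. N (f i - f j) < \<epsilon>}"

definition completion :: "('v::ab_group_add \<Rightarrow> real) \<Rightarrow> (nat \<Rightarrow> 'v) set set" where
  "completion N = cauchy_seqs N //
     {(f, h). f \<in> cauchy_seqs N \<and> h \<in> cauchy_seqs N \<and> (\<lambda>i. N (f i - h i)) \<longlonglongrightarrow> 0}"

definition completion_norm :: "('v::ab_group_add \<Rightarrow> real) \<Rightarrow> (nat \<Rightarrow> 'v) set \<Rightarrow> real" where
  "completion_norm N X = (THE r. \<forall>f\<in>X. (\<lambda>i. N (f i)) \<longlonglongrightarrow> r)"

text \<open>The continuous extension of \<open>\<iota>\<close> to a completion.\<close>

definition extend_to_completion :: "('v \<Rightarrow> 'a::t2_space) \<Rightarrow> (nat \<Rightarrow> 'v) set \<Rightarrow> 'a" where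
  "extend_to_completion \<iota> X = (THE a. \<forall>f\<in>X. (\<lambda>i. \<iota> (f i)) \<longlonglongrightarrow> a)"

definition T_set ::
  "(complex \<Rightarrow> 'a \<Rightarrow> 'a) \<Rightarrow> (('g::group_add \<Rightarrow>\<^sub>0 complex) \<Rightarrow> 'a) \<Rightarrow> 'g set \<Rightarrow> 'a set \<Rightarrow> nat
    \<Rightarrow> ('g \<Rightarrow>\<^sub>0 complex) set" where
  "T_set scaleC \<iota> S U n =
     {a. (\<forall>g\<in>Poly_Mapping.keys a. word_length S g \<le> n) \<and>
         \<iota> a \<in> scaleC (complex_of_real (real n / real (n + 1))) ` U}"

text \<open>Greatest with respect to the pointwise order on functions.\<close>

definition norm_n ::
  "(complex \<Rightarrow> 'a \<Rightarrow> 'a) \<Rightarrow> (('g::group_add \<Rightarrow>\<^sub>0 complex) \<Rightarrow> 'a) \<Rightarrow> 'g set \<Rightarrow> 'a set \<Rightarrow> nat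
    \<Rightarrow> ('g \<Rightarrow>\<^sub>0 complex) \<Rightarrow> real" where
  "norm_n scaleC \<iota> S U n =
     (GREATEST N. seminorm gr_scale N \<and> unconditional N \<and> submultiplicative N \<and>
                  (\<forall>t\<in>T_set scaleC \<iota> S U n. N t \<le> 1))"

definition A_n ::
  "(complex \<Rightarrow> 'a \<Rightarrow> 'a) \<Rightarrow> (('g::group_add \<Rightarrow>\<^sub>0 complex) \<Rightarrow> 'a) \<Rightarrow> 'g set \<Rightarrow> 'a set \<Rightarrow> nat
    \<Rightarrow> (nat \<Rightarrow> 'g \<Rightarrow>\<^sub>0 complex) set set" where
  "A_n scaleC \<iota> S U n = completion (norm_n scaleC \<iota> S U n)"

text \<open>
  The union is formed inside the Frechet algebra, into which each completion is mapped by the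
  continuous extension of \<open>\<iota>\<close>.
\<close>

definition A_omega ::
  "(complex \<Rightarrow> 'a::t2_space \<Rightarrow> 'a) \<Rightarrow> (('g::group_add \<Rightarrow>\<^sub>0 complex) \<Rightarrow> 'a) \<Rightarrow> 'g set \<Rightarrow> 'a set
    \<Rightarrow> 'a set" where
  "A_omega scaleC \<iota> S U = (\<Union>n\<in>{1..}. extend_to_completion \<iota> ` A_n scaleC \<iota> S U n)"

definition l1 :: "('g \<Rightarrow> complex) set" where
  "l1 = {b. (\<lambda>g. cmod (b g)) summable_on UNIV}"

definition l1_norm :: "('g \<Rightarrow> complex) \<Rightarrow> real" where
  "l1_norm b = (\<Sum>\<^sub>\<infinity>g. cmod (b g))"

end

theory Submission
  imports Defs
begin

text \<open>
  Multiplication by \<open>\<chi>\<close>, the characteristic function of the conjugacy class of \<open>x\<close>, is bounded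
  because every product \<open>a = t\<^sub>1 \<cdots> t\<^sub>k\<close> of elements of \<open>T_n\<close> satisfies \<open>\<parallel>\<chi> a\<parallel>\<^sub>1 \<le> C\<close> with \<open>C\<close>
  independent of \<open>k\<close>; such a bound on words passes to the largest unconditional submultiplicative
  seminorm that is at most \<open>1\<close> on \<open>T_n\<close> (lemma \<open>seminorm_le_gauge_seminorm\<close>). Since all seminorms
  involved are unconditional, the factors may be assumed to have nonnegative coefficients. Two effects
  then compete.

  Decay. Elements of \<open>T_n\<close> are elements of \<open>U\<close> scaled by \<open>n / (n + 1)\<close> with support in a fixed
  finite set. Finitely many elements of \<open>U\<close> majorise all of them, up to a factor \<open>\<theta> < 1\<close>
  (\<open>finite_majorants\<close>), and words in a finite subset of \<open>U\<close> are bounded because \<open>U\<close> is an open unit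
  ball. So every continuous unconditional seminorm of \<open>t\<^sub>1 \<cdots> t\<^sub>k\<close> is \<open>O(\<theta>\<^sup>k)\<close>
  (\<open>word_decay\<close>), which applies in particular to each coefficient.

  Growth. A word \<open>g\<^sub>1 \<dots> g\<^sub>k\<close> in the supports with product \<open>y\<close> conjugate to \<open>x\<close> is a path from \<open>0\<close> to
  \<open>y\<close> in the Cayley graph. Hyperbolicity gives a point near the geodesics from \<open>0\<close> to \<open>y\<close> that \<open>y\<close>
  moves by a bounded amount (\<open>conjugate_branch_point\<close>), and the path comes within \<open>O(log k)\<close> of it
  (\<open>gromov_product_path\<close>). Starting the word at that place rotates it to one whose product has length
  \<open>O(log k)\<close> (\<open>short_rotation\<close>). As rotations preserve the coefficients of words, the norm of \<open>\<chi> a\<close> is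
  at most the sum of \<open>k + 1\<close> rotated products over a ball of radius \<open>O(log k)\<close>
  (\<open>sum_coefs_le_rotations\<close>), hence polynomial in \<open>k\<close> times \<open>\<theta>\<^sup>k\<close>.

  The decay also bounds the seminorms of the Frechet algebra by those of the completions. Thus classes
  of Cauchy sequences have limits in the algebra, on which coefficients are defined by continuity, and
  the bound on the group ring passes to the limit.
\<close>

section \<open>Coefficients in the group ring\<close>

abbreviation coef :: "('g \<Rightarrow>\<^sub>0 'b::zero) \<Rightarrow> 'g \<Rightarrow> 'b" where
  "coef \<equiv> Poly_Mapping.lookup"

abbreviation gr_monom :: "'g \<Rightarrow> complex \<Rightarrow> ('g \<Rightarrow>\<^sub>0 complex)" where
  "gr_monom \<equiv> Poly_Mapping.single"

lemma coef_gr_scale [simp]: "coef (gr_scale c a) g = c * coef a g"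
  by (simp add: gr_scale_def map.rep_eq when_def)

lemma coef_gr_abs [simp]: "coef (gr_abs a) g = complex_of_real (cmod (coef a g))"
  by (simp add: gr_abs_def map.rep_eq when_def)

lemma gr_scale_one [simp]: "gr_scale 1 a = a"
  by (rule poly_mapping_eqI) simp

lemma gr_scale_gr_scale [simp]: "gr_scale c (gr_scale d a) = gr_scale (c * d) a"
  by (rule poly_mapping_eqI) (simp add: mult.assoc)

lemma gr_scale_zero [simp]: "gr_scale 0 a = 0"
  by (rule poly_mapping_eqI) simp

lemma gr_scale_monom: "gr_scale c (gr_monom g d) = gr_monom g (c * d)"
  by (rule poly_mapping_eqI) (simp add: lookup_single when_def)

lemma coef_times:
  fixes a b :: "'g::group_add \<Rightarrow>\<^sub>0 complex"
  assumes "finite H" and "Poly_Mapping.keys a \<subseteq> H"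
  shows "coef (a * b) g = (\<Sum>h\<in>H. coef a h * coef b (- h + g))"
proof -
  have eq: "(\<Sum>q. coef b q when g = h + q) = coef b (- h + g)" for h
  proof -
    have "(g = h + q) = (q = - h + g)" for q
      by (metis add.assoc add.left_neutral left_minus right_minus)
    then show ?thesis by simp
  qed
  have "coef (a * b) g = (\<Sum>h. coef a h * coef b (- h + g))"
    by (simp add: lookup_mult eq)
  also have "\<dots> = (\<Sum>h\<in>H. coef a h * coef b (- h + g))"
    using assms by (intro Sum_any.expand_superset) (auto simp: in_keys_iff)
  finally show ?thesis .
qed

lemma coef_monom_times:
  "coef (gr_monom h c * b) g = c * coef b (- h + g)" for b :: "'g::group_add \<Rightarrow>\<^sub>0 complex"
  by (subst coef_times[of "{h}"]) (auto simp: lookup_single)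

lemma gr_scale_times: "gr_scale c a * b = gr_scale c (a * b)"
  for a :: "'g::group_add \<Rightarrow>\<^sub>0 complex"
proof (rule poly_mapping_eqI)
  fix g
  have "Poly_Mapping.keys (gr_scale c a) \<subseteq> Poly_Mapping.keys a"
    by (auto simp: in_keys_iff)
  then show "coef (gr_scale c a * b) g = coef (gr_scale c (a * b)) g"
    by (simp add: coef_times[of "Poly_Mapping.keys a"] sum_distrib_left mult.assoc)
qed

lemma times_gr_scale: "a * gr_scale c b = gr_scale c (a * b)"
  for a :: "'g::group_add \<Rightarrow>\<^sub>0 complex"
  by (rule poly_mapping_eqI)
    (simp add: coef_times[of "Poly_Mapping.keys a"] sum_distrib_left mult.left_commute)

text \<open>
  Estimates in the group ring pass through elements with nonnegative coefficients, for which the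
  coefficients of a product depend monotonically on the factors.
\<close>

definition majorised :: "('g \<Rightarrow>\<^sub>0 complex) \<Rightarrow> ('g \<Rightarrow>\<^sub>0 complex) \<Rightarrow> bool" where
  "majorised a b \<longleftrightarrow> (\<forall>g. Im (coef b g) = 0 \<and> cmod (coef a g) \<le> Re (coef b g))"

abbreviation nonneg_coefs :: "('g \<Rightarrow>\<^sub>0 complex) \<Rightarrow> bool" where
  "nonneg_coefs a \<equiv> majorised a a"

lemma majorised_gr_abs [simp]: "majorised a (gr_abs a)"
  by (simp add: majorised_def)

lemma nonneg_gr_abs [simp]: "nonneg_coefs (gr_abs a)"
  by (simp add: majorised_def)

lemma nonneg_monom: "0 \<le> r \<Longrightarrow> nonneg_coefs (gr_monom g (complex_of_real r))"
  by (simp add: majorised_def lookup_single when_def)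

lemma nonneg_one [simp]: "nonneg_coefs (1 :: 'g::group_add \<Rightarrow>\<^sub>0 complex)"
  by (simp add: majorised_def lookup_one when_def)

lemma nonneg_coefs_Re: "nonneg_coefs a \<Longrightarrow> 0 \<le> Re (coef a g)"
  by (metis majorised_def norm_ge_zero order_trans)

lemma nonneg_coefs_eq: "nonneg_coefs a \<Longrightarrow> coef a g = complex_of_real (Re (coef a g))"
  by (simp add: majorised_def complex_eq_iff)

lemma nonneg_coefs_cmod: "nonneg_coefs a \<Longrightarrow> cmod (coef a g) = Re (coef a g)"
  by (metis abs_of_nonneg nonneg_coefs_Re nonneg_coefs_eq norm_of_real)

lemma majorised_add:
  assumes "majorised a b" and "majorised c d"
  shows "majorised (a + c) (b + d)"
  unfolding majorised_def lookup_add
proof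
  fix g
  have "cmod (coef a g + coef c g) \<le> cmod (coef a g) + cmod (coef c g)"
    by (rule norm_triangle_ineq)
  then show "Im (coef b g + coef d g) = 0 \<and>
      cmod (coef a g + coef c g) \<le> Re (coef b g + coef d g)"
    using assms unfolding majorised_def by (smt (verit) plus_complex.simps)
qed

lemma majorised_times:
  fixes a :: "'g::group_add \<Rightarrow>\<^sub>0 complex"
  assumes ab: "majorised a b" and cd: "majorised c d"
  shows "majorised (a * c) (b * d)"
  unfolding majorised_def
proof
  fix g
  define H where "H = Poly_Mapping.keys a \<union> Poly_Mapping.keys b"
  have H: "finite H" "Poly_Mapping.keys a \<subseteq> H" "Poly_Mapping.keys b \<subseteq> H"
    by (auto simp: H_def)
  have im: "Im (coef b h) = 0" "Im (coef d h) = 0" for h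
    using ab cd by (auto simp: majorised_def)
  have le: "cmod (coef a h) \<le> Re (coef b h)" "cmod (coef c h) \<le> Re (coef d h)" for h
    using ab cd by (auto simp: majorised_def)
  have "cmod (coef (a * c) g) \<le> (\<Sum>h\<in>H. cmod (coef a h * coef c (- h + g)))"
    unfolding coef_times[OF H(1,2)] by (rule norm_sum)
  also have "\<dots> \<le> (\<Sum>h\<in>H. Re (coef b h) * Re (coef d (- h + g)))"
    unfolding norm_mult
    by (intro sum_mono mult_mono le norm_ge_zero order_trans[OF norm_ge_zero le(1)])
  also have "\<dots> = Re (coef (b * d) g)"
    unfolding coef_times[OF H(1,3)] by (simp add: im)
  finally show "Im (coef (b * d) g) = 0 \<and> cmod (coef (a * c) g) \<le> Re (coef (b * d) g)"
    unfolding coef_times[OF H(1,3)] by (simp add: im)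
qed

lemma nonneg_prod_list:
  "(\<And>a. a \<in> set as \<Longrightarrow> nonneg_coefs a) \<Longrightarrow> nonneg_coefs (prod_list as)"
  for as :: "('g::group_add \<Rightarrow>\<^sub>0 complex) list"
  by (induction as) (simp_all add: majorised_times)

lemma unconditional_majorised: "unconditional N \<Longrightarrow> majorised a b \<Longrightarrow> N a \<le> N b"
  unfolding unconditional_def majorised_def by (meson complex_Re_le_cmod order_trans)

lemma unconditional_gr_abs: "unconditional N \<Longrightarrow> N (gr_abs a) = N a"
  unfolding unconditional_def by (intro order_antisym) simp_all

lemma seminorm_zero:
  assumes "seminorm gr_scale N" shows "N 0 = 0"
proof -
  have "N (gr_scale 0 0) = cmod 0 * N 0"
    using assms unfolding seminorm_def by blast
  then show ?thesis by simp
qed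

lemma seminorm_scale: "seminorm gr_scale N \<Longrightarrow> N (gr_scale c a) = cmod c * N a"
  by (simp add: seminorm_def)

lemma seminorm_triangle: "seminorm gr_scale N \<Longrightarrow> N (a + b) \<le> N a + N b"
  by (simp add: seminorm_def)

lemma seminorm_nonneg: "seminorm gr_scale N \<Longrightarrow> 0 \<le> N a"
  by (simp add: seminorm_def)

lemma gr_scale_minus_one: "gr_scale (- 1) a = - a"
  by (rule poly_mapping_eqI) simp

lemma seminorm_minus_commute:
  assumes "seminorm gr_scale N" shows "N (a - b) = N (b - a)"
  using seminorm_scale[OF assms, of "-1" "a - b"] by (simp add: gr_scale_minus_one)

lemma seminorm_diff_le:
  assumes "seminorm gr_scale N" shows "\<bar>N a - N b\<bar> \<le> N (a - b)"
  using seminorm_triangle[OF assms, of "a - b" b] seminorm_triangle[OF assms, of "b - a" a]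
    seminorm_minus_commute[OF assms, of a b] by simp

lemma seminorm_sum_coefs:
  "seminorm gr_scale (\<lambda>a. \<Sum>g\<in>G. cmod (coef a g))"
  unfolding seminorm_def
  by (auto simp: norm_mult sum_distrib_left sum_nonneg lookup_add sum.distrib[symmetric]
      intro!: sum_mono norm_triangle_ineq)

lemma unconditional_sum_coefs: "unconditional (\<lambda>a. \<Sum>g\<in>G. cmod (coef a g))"
  by (simp add: unconditional_def sum_mono)

section \<open>The largest unconditional submultiplicative seminorm\<close>

text \<open>
  The seminorms competing in the definition of \<open>norm_n\<close> are those that satisfy every bound
  generated from \<open>N t \<le> 1\<close> on \<open>T\<close> by the rules of such a seminorm. The
  infimum of the generated bounds obeys the same rules, so it is the largest competitor; this gives
  both that the largest one exists and an induction principle for upper bounds of other seminorms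
  by it.
\<close>

inductive generated_bound ::
  "('g::group_add \<Rightarrow>\<^sub>0 complex) set \<Rightarrow> ('g \<Rightarrow>\<^sub>0 complex) \<Rightarrow> real \<Rightarrow> bool"
  for T where
  gen: "t \<in> T \<Longrightarrow> generated_bound T t 1"
| times: "generated_bound T a r \<Longrightarrow> generated_bound T b s \<Longrightarrow> generated_bound T (a * b) (r * s)"
| plus: "generated_bound T a r \<Longrightarrow> generated_bound T b s \<Longrightarrow> generated_bound T (a + b) (r + s)"
| scale: "generated_bound T a r \<Longrightarrow> generated_bound T (gr_scale c a) (cmod c * r)"
| mono: "generated_bound T b r \<Longrightarrow> (\<And>g. cmod (coef a g) \<le> cmod (coef b g)) \<Longrightarrow> generated_bound T a r"

definition gauge_seminorm :: "('g::group_add \<Rightarrow>\<^sub>0 complex) set \<Rightarrow> ('g \<Rightarrow>\<^sub>0 complex) \<Rightarrow> real" where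
  "gauge_seminorm T a = Inf {r. generated_bound T a r}"

definition bounding_seminorm ::
  "('g::group_add \<Rightarrow>\<^sub>0 complex) set \<Rightarrow> (('g \<Rightarrow>\<^sub>0 complex) \<Rightarrow> real) \<Rightarrow> bool" where
  "bounding_seminorm T N \<longleftrightarrow>
     seminorm gr_scale N \<and> unconditional N \<and> submultiplicative N \<and> (\<forall>t\<in>T. N t \<le> 1)"

lemma generated_bound_nonneg: "generated_bound T a r \<Longrightarrow> 0 \<le> r"
  by (induction rule: generated_bound.induct) auto

lemma gauge_seminorm_le: "generated_bound T a r \<Longrightarrow> gauge_seminorm T a \<le> r"
  unfolding gauge_seminorm_def
  by (rule cInf_lower) (auto intro!: bdd_belowI[of _ 0] generated_bound_nonneg)

lemma le_gauge_seminorm: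
  assumes "\<exists>r. generated_bound T a r" and "\<And>r. generated_bound T a r \<Longrightarrow> x \<le> r"
  shows "x \<le> gauge_seminorm T a"
  unfolding gauge_seminorm_def by (rule cInf_greatest) (use assms in auto)

lemma bounding_seminorm_le:
  assumes N: "bounding_seminorm T N" and "generated_bound T a r"
  shows "N a \<le> r"
  using assms(2)
proof (induction rule: generated_bound.induct)
  case (gen t)
  then show ?case using N by (auto simp: bounding_seminorm_def)
next
  case (times a r b s)
  have "N (a * b) \<le> N a * N b"
    using N by (auto simp: bounding_seminorm_def submultiplicative_def)
  also have "\<dots> \<le> r * s"
    using N times.IH times.hyps generated_bound_nonneg
    by (intro mult_mono) (auto simp: bounding_seminorm_def seminorm_def)
  finally show ?case .
next
  case (plus a r b s)
  have "N (a + b) \<le> N a + N b"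
    using N by (auto simp: bounding_seminorm_def seminorm_def)
  with plus show ?case by simp
next
  case (scale a r c)
  then show ?case
    using N by (auto simp: bounding_seminorm_def seminorm_def intro: mult_left_mono)
next
  case (mono b r a)
  then show ?case
    using N unfolding bounding_seminorm_def unconditional_def by (meson order_trans)
qed

lemma bounding_gauge_seminorm:
  assumes ex: "\<And>a. \<exists>r. generated_bound T a r"
  shows "bounding_seminorm T (gauge_seminorm T)"
proof -
  let ?N = "gauge_seminorm T"
  have nonneg: "0 \<le> ?N a" for a
    by (rule le_gauge_seminorm[OF ex generated_bound_nonneg])
  have triangle: "?N (a + b) \<le> ?N a + ?N b" for a b
  proof -
    have "?N (a + b) - s \<le> ?N a" if "generated_bound T b s" for s
      by (rule le_gauge_seminorm[OF ex])
        (use gauge_seminorm_le[OF generated_bound.plus[OF _ that]] in fastforce)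
    then have "?N (a + b) - ?N a \<le> s" if "generated_bound T b s" for s
      using that by (smt (verit))
    then have "?N (a + b) - ?N a \<le> ?N b"
      by (intro le_gauge_seminorm[OF ex])
    then show ?thesis by simp
  qed
  have submult: "?N (a * b) \<le> ?N a * ?N b" for a b
  proof -
    have le: "?N (a * b) \<le> r * s" if "generated_bound T a r" "generated_bound T b s" for r s
      by (rule gauge_seminorm_le[OF generated_bound.times[OF that]])
    have "?N (a * b) \<le> ?N a * s" if s: "generated_bound T b s" for s
    proof (cases "s = 0")
      case True
      then show ?thesis using ex[of a] le[OF _ s] by auto
    next
      case False
      with generated_bound_nonneg[OF s] have "0 < s" by simp
      have "?N (a * b) / s \<le> ?N a"
        by (rule le_gauge_seminorm[OF ex]) (use le[OF _ s] \<open>0 < s\<close> in \<open>simp add: divide_le_eq\<close>)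
      then show ?thesis using \<open>0 < s\<close> by (simp add: divide_le_eq)
    qed
    note le' = this
    show ?thesis
    proof (cases "?N a = 0")
      case True
      then show ?thesis using ex[of b] le' by auto
    next
      case False
      with nonneg[of a] have "0 < ?N a" by simp
      have "?N (a * b) / ?N a \<le> ?N b"
        by (rule le_gauge_seminorm[OF ex])
          (use le' \<open>0 < ?N a\<close> in \<open>simp add: divide_le_eq mult.commute\<close>)
      then show ?thesis using \<open>0 < ?N a\<close> by (simp add: divide_le_eq mult.commute)
    qed
  qed
  have scale_le: "?N (gr_scale c a) \<le> cmod c * ?N a" for c a
  proof (cases "c = 0")
    case True
    obtain r where "generated_bound T a r" using ex by blast
    from gauge_seminorm_le[OF generated_bound.scale[OF this, of c]] True show ?thesis by simp
  next
    case False
    have "?N (gr_scale c a) / cmod c \<le> ?N a"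
      by (rule le_gauge_seminorm[OF ex])
        (use gauge_seminorm_le[OF generated_bound.scale] False in
          \<open>simp add: divide_le_eq mult.commute\<close>)
    then show ?thesis using False by (simp add: divide_le_eq mult.commute)
  qed
  have scale: "?N (gr_scale c a) = cmod c * ?N a" for c a
  proof (cases "c = 0")
    case True
    then show ?thesis using scale_le[of c a] nonneg[of "gr_scale c a"] by simp
  next
    case False
    have "?N (gr_scale (inverse c) (gr_scale c a)) \<le> cmod (inverse c) * ?N (gr_scale c a)"
      by (rule scale_le)
    then have "cmod c * ?N a \<le> ?N (gr_scale c a)"
      using False by (simp add: norm_inverse norm_divide field_simps)
    then show ?thesis using scale_le[of c a] by simp
  qed
  have "unconditional ?N"
    unfolding unconditional_def
    by (intro allI impI le_gauge_seminorm[OF ex] gauge_seminorm_le)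
      (auto intro: generated_bound.mono)
  moreover have "\<forall>t\<in>T. ?N t \<le> 1"
    by (auto intro: gauge_seminorm_le generated_bound.gen)
  ultimately show ?thesis
    using nonneg triangle scale submult
    by (simp add: bounding_seminorm_def seminorm_def submultiplicative_def)
qed

lemma Greatest_bounding_seminorm:
  assumes ex: "\<And>a. \<exists>r. generated_bound T a r"
  shows "(GREATEST N. bounding_seminorm T N) = gauge_seminorm T"
  by (intro Greatest_equality bounding_gauge_seminorm ex le_funI le_gauge_seminorm)
    (auto intro: bounding_seminorm_le)

text \<open>
  Since a finitely supported element is a finite combination of monomials, it is enough to bound
  the group elements.
\<close>

lemma generated_bound_exists:
  assumes "0 \<in> T" and "\<And>g. \<exists>r. generated_bound T (gr_monom g 1) r"
  shows "\<exists>r. generated_bound T a r"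
proof -
  have single: "\<exists>r. generated_bound T (gr_monom g c) r" for g c
    using assms(2)[of g] generated_bound.scale[of T "gr_monom g 1" _ c]
    by (auto simp: gr_scale_monom)
  have "\<exists>r. generated_bound T (\<Sum>g\<in>G. gr_monom g (coef a g)) r" if "finite G" for G
    using that
  proof (induction G)
    case empty
    then show ?case using generated_bound.gen[OF assms(1)] by auto
  next
    case (insert g G)
    then show ?case using single[of g "coef a g"] generated_bound.plus by force
  qed
  moreover have "(\<Sum>g\<in>Poly_Mapping.keys a. gr_monom g (coef a g)) = a"
    by (rule poly_mapping_eqI) (simp add: lookup_sum lookup_single when_def in_keys_iff)
  ultimately show ?thesis
    using finite_keys[of a] by metis
qed

text \<open>
  A seminorm that is bounded by \<open>C\<close> on the words in \<open>T\<close> is bounded by \<open>C\<close> times the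
  largest seminorm. As \<open>p\<close> itself is not submultiplicative, the induction compares \<open>a\<close> as a left
  multiplication operator: it enlarges the supremum of \<open>p (w * b)\<close> over all words \<open>w\<close> at most by the
  generated bound, for every \<open>b\<close>.
\<close>

lemma seminorm_le_gauge_seminorm:
  fixes p :: "('g::group_add \<Rightarrow>\<^sub>0 complex) \<Rightarrow> real"
  assumes p: "seminorm gr_scale p" "unconditional p"
    and words: "\<And>ts. set ts \<subseteq> T \<Longrightarrow> p (prod_list (map gr_abs ts)) \<le> C"
    and ex: "\<And>a. \<exists>r. generated_bound T a r"
  shows "p a \<le> C * gauge_seminorm T a"
proof -
  define W where "W = {prod_list (map gr_abs ts) | ts. set ts \<subseteq> T}"
  have one_W: "1 \<in> W"
    unfolding W_def by (auto intro!: exI[of _ "[]"])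
  have W_times: "w * gr_abs t \<in> W" if w: "w \<in> W" and t: "t \<in> T" for w t
  proof -
    obtain ts where ts: "w = prod_list (map gr_abs ts)" "set ts \<subseteq> T"
      using w by (auto simp: W_def)
    then show ?thesis using t unfolding W_def by (auto intro!: exI[of _ "ts @ [t]"])
  qed
  have W_nonneg: "nonneg_coefs w" if "w \<in> W" for w
    using that by (auto simp: W_def intro!: nonneg_prod_list)
  have key: "\<forall>w\<in>W. p (w * (gr_abs a * b)) \<le> r * M"
    if "generated_bound T a r" "nonneg_coefs b" "\<forall>w\<in>W. p (w * b) \<le> M" for a b r M
    using that
  proof (induction arbitrary: b M rule: generated_bound.induct)
    case (gen t)
    then show ?case using W_times by (simp add: mult.assoc[symmetric])
  next
    case (times a r a' s)
    have "\<forall>w\<in>W. p (w * (gr_abs a' * b)) \<le> s * M"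
      by (rule times.IH(2)[OF times.prems])
    from times.IH(1)[OF majorised_times[OF nonneg_gr_abs times.prems(1)] this]
    have le: "p (w * (gr_abs a * (gr_abs a' * b))) \<le> r * (s * M)" if "w \<in> W" for w
      using that by blast
    have "majorised (gr_abs (a * a')) (gr_abs a * gr_abs a')"
      using majorised_times[OF majorised_gr_abs majorised_gr_abs, of a a']
      by (simp add: majorised_def)
    then have "majorised (w * (gr_abs (a * a') * b)) (w * (gr_abs a * gr_abs a' * b))"
      if "w \<in> W" for w
      by (intro majorised_times W_nonneg[OF that] times.prems(1))
    from unconditional_majorised[OF p(2) this] show ?case
      using le by (force simp: mult.assoc intro: order_trans)
  next
    case (plus a r a' s)
    show ?case
    proof
      fix w assume w: "w \<in> W"
      have "majorised (gr_abs (a + a')) (gr_abs a + gr_abs a')"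
        using majorised_add[OF majorised_gr_abs majorised_gr_abs, of a a']
        by (simp add: majorised_def)
      then have "majorised (w * (gr_abs (a + a') * b)) (w * ((gr_abs a + gr_abs a') * b))"
        by (intro majorised_times W_nonneg[OF w] plus.prems(1))
      then have "p (w * (gr_abs (a + a') * b)) \<le> p (w * (gr_abs a * b) + w * (gr_abs a' * b))"
        using unconditional_majorised[OF p(2)] by (simp add: distrib_left distrib_right)
      also have "\<dots> \<le> p (w * (gr_abs a * b)) + p (w * (gr_abs a' * b))"
        by (rule seminorm_triangle[OF p(1)])
      also have "\<dots> \<le> r * M + s * M"
        using plus.IH[OF plus.prems] w by (intro add_mono) auto
      finally show "p (w * (gr_abs (a + a') * b)) \<le> (r + s) * M"
        by (simp add: distrib_right)
    qed
  next
    case (scale a r c)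
    show ?case
    proof
      fix w assume w: "w \<in> W"
      have "gr_abs (gr_scale c a) = gr_scale (complex_of_real (cmod c)) (gr_abs a)"
        by (rule poly_mapping_eqI) (simp add: norm_mult)
      then have "p (w * (gr_abs (gr_scale c a) * b)) = cmod c * p (w * (gr_abs a * b))"
        by (simp add: gr_scale_times times_gr_scale seminorm_scale[OF p(1)])
      also have "\<dots> \<le> cmod c * (r * M)"
        using scale.IH[OF scale.prems] w by (intro mult_left_mono) auto
      finally show "p (w * (gr_abs (gr_scale c a) * b)) \<le> cmod c * r * M"
        by (simp add: mult.assoc)
    qed
  next
    case (mono a' r a)
    have "majorised (gr_abs a) (gr_abs a')"
      using mono.hyps(2) by (simp add: majorised_def)
    then have "majorised (w * (gr_abs a * b)) (w * (gr_abs a' * b))" if "w \<in> W" for w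
      by (intro majorised_times W_nonneg[OF that] mono.prems(1))
    then show ?case
      using mono.IH[OF mono.prems] unconditional_majorised[OF p(2)] by (blast intro: order_trans)
  qed
  have C: "0 \<le> C"
    using words[of "[]"] seminorm_nonneg[OF p(1), of 1] by simp
  have le: "p a \<le> r * C" if r: "generated_bound T a r" for r
  proof -
    have "\<forall>w\<in>W. p (w * 1) \<le> C"
      using words by (auto simp: W_def)
    from key[OF r nonneg_one this] one_W have "p (gr_abs a) \<le> r * C"
      by force
    then show ?thesis by (simp add: unconditional_gr_abs[OF p(2)])
  qed
  show ?thesis
  proof (cases "C = 0")
    case True
    then show ?thesis using ex[of a] le by auto
  next
    case False
    with C have "0 < C" by simp
    then have "p a / C \<le> gauge_seminorm T a"
      by (intro le_gauge_seminorm ex) (simp add: divide_le_eq le)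
    then show ?thesis using \<open>0 < C\<close> by (simp add: divide_le_eq mult.commute)
  qed
qed

section \<open>Products as sums over words\<close>

definition support_words :: "('g \<Rightarrow>\<^sub>0 complex) list \<Rightarrow> 'g list set" where
  "support_words ts = {gs. list_all2 (\<lambda>g t. g \<in> Poly_Mapping.keys t) gs ts}"

definition word_coef :: "('g \<Rightarrow>\<^sub>0 complex) list \<Rightarrow> 'g list \<Rightarrow> complex" where
  "word_coef ts gs = prod_list (map2 coef ts gs)"

lemma support_words_Nil: "support_words [] = {[]}"
  by (auto simp: support_words_def)

lemma support_words_Cons:
  "support_words (t # ts) = (\<lambda>(g, gs). g # gs) ` (Poly_Mapping.keys t \<times> support_words ts)"
  by (auto simp: support_words_def list_all2_Cons2 image_iff)

lemma finite_support_words: "finite (support_words ts)"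
  by (induction ts) (simp_all add: support_words_Nil support_words_Cons)

lemma coef_prod_list:
  fixes ts :: "('g::group_add \<Rightarrow>\<^sub>0 complex) list"
  shows "coef (prod_list ts) g =
    (\<Sum>gs\<in>support_words ts. if sum_list gs = g then word_coef ts gs else 0)"
proof (induction ts arbitrary: g)
  case Nil
  then show ?case
    by (auto simp: support_words_Nil word_coef_def lookup_one when_def)
next
  case (Cons t ts)
  have shift: "sum_list gs = - h + g \<longleftrightarrow> h + sum_list gs = g" for h gs
    by (metis add.assoc add.left_neutral left_minus right_minus)
  have "coef (prod_list (t # ts)) g =
      (\<Sum>h\<in>Poly_Mapping.keys t. coef t h *
        (\<Sum>gs\<in>support_words ts. if sum_list gs = - h + g then word_coef ts gs else 0))"
    by (simp add: coef_times[of "Poly_Mapping.keys t"] Cons.IH)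
  also have "\<dots> = (\<Sum>h\<in>Poly_Mapping.keys t. \<Sum>gs\<in>support_words ts.
        if sum_list (h # gs) = g then word_coef (t # ts) (h # gs) else 0)"
    unfolding sum_distrib_left
    by (intro sum.cong refl) (simp add: word_coef_def shift)
  also have "\<dots> = (\<Sum>gs\<in>support_words (t # ts).
        if sum_list gs = g then word_coef (t # ts) gs else 0)"
    unfolding support_words_Cons sum.cartesian_product
    by (subst sum.reindex) (auto simp: inj_on_def intro!: sum.cong)
  finally show ?case .
qed

lemma sum_coef_prod_list:
  fixes ts :: "('g::group_add \<Rightarrow>\<^sub>0 complex) list"
  assumes "finite G"
  shows "(\<Sum>g\<in>G. coef (prod_list ts) g) =
    (\<Sum>gs\<in>support_words ts. if sum_list gs \<in> G then word_coef ts gs else 0)"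
  unfolding coef_prod_list by (subst sum.swap) (simp add: sum.delta'[OF assms])

abbreviation rotation :: "nat \<Rightarrow> 'b list \<Rightarrow> 'b list" where
  "rotation i xs \<equiv> drop i xs @ take i xs"

lemma rotation_support_words:
  "gs \<in> support_words ts \<Longrightarrow> rotation i gs \<in> support_words (rotation i ts)"
  by (auto simp: support_words_def intro!: list_all2_appendI)

lemma word_coef_rotation:
  assumes "length gs = length ts"
  shows "word_coef (rotation i ts) (rotation i gs) = word_coef ts gs"
proof -
  have "map2 coef (rotation i ts) (rotation i gs) = rotation i (map2 coef ts gs)"
    using assms by (simp add: zip_append drop_zip take_zip drop_map take_map)
  then show ?thesis
    unfolding word_coef_def
    by (metis append_take_drop_id mult.commute prod_list.append)
qed

lemma inj_on_rotation: "inj_on (rotation i) (support_words ts)"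
proof (rule inj_onI)
  fix gs hs
  assume "gs \<in> support_words ts" "hs \<in> support_words ts" and eq: "rotation i gs = rotation i hs"
  then have "length gs = length hs"
    by (auto simp: support_words_def dest!: list_all2_lengthD)
  then have "length (drop i gs) = length (drop i hs)" by simp
  with eq have "drop i gs = drop i hs \<and> take i gs = take i hs" by simp
  then show "gs = hs" by (metis append_take_drop_id)
qed

lemma nonneg_word_coef:
  assumes "\<And>t. t \<in> set ts \<Longrightarrow> nonneg_coefs t" and "length gs = length ts"
  shows "Im (word_coef ts gs) = 0 \<and> 0 \<le> Re (word_coef ts gs)"
  using assms(2,1)
proof (induction gs ts rule: list_induct2)
  case Nil
  then show ?case by (simp add: word_coef_def)
next
  case (Cons g gs t ts)
  have "Im (coef t g) = 0" "0 \<le> Re (coef t g)"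
    using Cons.prems[of t] nonneg_coefs_Re by (auto simp: majorised_def)
  then show ?case using Cons by (simp add: word_coef_def)
qed

text \<open>
  Rotating the factors of a product permutes the words cyclically without changing their
  coefficients. Hence, if every word with product in \<open>G\<close> has a rotation with product in \<open>B\<close>,
  the mass of a product on \<open>G\<close> is at most the mass of its rotations on \<open>B\<close>.
\<close>

lemma sum_coefs_le_rotations:
  fixes ts :: "('g::group_add \<Rightarrow>\<^sub>0 complex) list"
  assumes nonneg: "\<And>t. t \<in> set ts \<Longrightarrow> nonneg_coefs t"
    and fin: "finite G" "finite B"
    and rot: "\<And>gs. gs \<in> support_words ts \<Longrightarrow> sum_list gs \<in> G \<Longrightarrow>
        \<exists>i\<le>length ts. sum_list (rotation i gs) \<in> B"
  shows "(\<Sum>g\<in>G. cmod (coef (prod_list ts) g)) \<le>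
    (\<Sum>i\<le>length ts. \<Sum>g\<in>B. cmod (coef (prod_list (rotation i ts)) g))"
proof -
  have len: "length gs = length ts" if "gs \<in> support_words ts" for gs ts :: "_ list"
    using that by (auto simp: support_words_def dest: list_all2_lengthD)
  have nonneg_rot: "nonneg_coefs t" if "t \<in> set (rotation i ts)" for t i
    using that nonneg by (auto dest: in_set_dropD in_set_takeD)
  have mass: "(\<Sum>g\<in>H. cmod (coef (prod_list us) g)) =
      (\<Sum>gs\<in>support_words us. if sum_list gs \<in> H then Re (word_coef us gs) else 0)"
    if "finite H" "\<And>t. t \<in> set us \<Longrightarrow> nonneg_coefs t" for H and us :: "('g \<Rightarrow>\<^sub>0 complex) list"
  proof -
    have "(\<Sum>g\<in>H. cmod (coef (prod_list us) g)) = Re (\<Sum>g\<in>H. coef (prod_list us) g)"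
      using nonneg_prod_list[of us] that(2) by (simp add: nonneg_coefs_cmod)
    also have "\<dots> = (\<Sum>gs\<in>support_words us. if sum_list gs \<in> H then Re (word_coef us gs) else 0)"
      unfolding sum_coef_prod_list[OF that(1)] by (auto intro!: sum.cong)
    finally show ?thesis .
  qed
  let ?c = "\<lambda>gs. Re (word_coef ts gs)"
  have c: "0 \<le> ?c gs" if "gs \<in> support_words ts" for gs
    using nonneg_word_coef[of ts gs] nonneg len[OF that] by blast
  have "(\<Sum>g\<in>G. cmod (coef (prod_list ts) g)) =
      (\<Sum>gs\<in>support_words ts. if sum_list gs \<in> G then ?c gs else 0)"
    by (rule mass[OF fin(1) nonneg])
  also have "\<dots> \<le> (\<Sum>gs\<in>support_words ts. \<Sum>i\<le>length ts.
      if sum_list (rotation i gs) \<in> B then ?c gs else 0)"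
  proof (rule sum_mono)
    fix gs assume gs: "gs \<in> support_words ts"
    have ge: "0 \<le> (\<Sum>i\<le>length ts. if sum_list (rotation i gs) \<in> B then ?c gs else 0)"
      using c[OF gs] by (intro sum_nonneg) auto
    show "(if sum_list gs \<in> G then ?c gs else 0) \<le>
        (\<Sum>i\<le>length ts. if sum_list (rotation i gs) \<in> B then ?c gs else 0)"
    proof (cases "sum_list gs \<in> G")
      case True
      then obtain i where i: "i \<le> length ts" "sum_list (rotation i gs) \<in> B"
        using rot[OF gs] by blast
      have "(if sum_list (rotation i gs) \<in> B then ?c gs else 0) \<le>
          (\<Sum>i\<le>length ts. if sum_list (rotation i gs) \<in> B then ?c gs else 0)"
        using i(1) c[OF gs] by (intro member_le_sum) auto
      then show ?thesis using True i(2) by simp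
    next
      case False
      then show ?thesis using ge by simp
    qed
  qed
  also have "\<dots> = (\<Sum>i\<le>length ts. \<Sum>gs\<in>support_words ts.
      if sum_list (rotation i gs) \<in> B then Re (word_coef (rotation i ts) (rotation i gs)) else 0)"
    by (subst sum.swap) (intro sum.cong refl, simp add: word_coef_rotation len)
  also have "\<dots> \<le> (\<Sum>i\<le>length ts. \<Sum>gs\<in>support_words (rotation i ts).
      if sum_list gs \<in> B then Re (word_coef (rotation i ts) gs) else 0)"
  proof (rule sum_mono)
    fix i
    let ?f = "\<lambda>gs. if sum_list gs \<in> B then Re (word_coef (rotation i ts) gs) else 0"
    have "(\<Sum>gs\<in>support_words ts. ?f (rotation i gs)) = sum ?f (rotation i ` support_words ts)"
      by (simp add: sum.reindex[OF inj_on_rotation])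
    also have "\<dots> \<le> sum ?f (support_words (rotation i ts))"
    proof (rule sum_mono2[OF finite_support_words])
      show "rotation i ` support_words ts \<subseteq> support_words (rotation i ts)"
        using rotation_support_words by blast
      fix gs assume "gs \<in> support_words (rotation i ts) - rotation i ` support_words ts"
      then show "0 \<le> ?f gs"
        using nonneg_word_coef[of "rotation i ts" gs] nonneg_rot[of _ i] len[of gs "rotation i ts"]
        by auto
    qed
    finally show "(\<Sum>gs\<in>support_words ts. ?f (rotation i gs)) \<le> sum ?f (support_words (rotation i ts))" .
  qed
  also have "\<dots> = (\<Sum>i\<le>length ts. \<Sum>g\<in>B. cmod (coef (prod_list (rotation i ts)) g))"
    by (simp only: mass[OF fin(2) nonneg_rot])
  finally show ?thesis .
qed

section \<open>The word metric\<close>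

locale fin_generated =
  fixes S :: "'g::group_add set"
  assumes gen: "fin_sym_generating_set S"
begin

lemma finite_S: "finite S"
  using gen by (simp add: fin_sym_generating_set_def)

lemma uminus_S: "s \<in> S \<Longrightarrow> - s \<in> S"
  using gen unfolding fin_sym_generating_set_def by blast

lemma word_length_word:
  obtains ws where "length ws = word_length S g" "set ws \<subseteq> S" "sum_list ws = g"
proof -
  have "\<exists>n ws. length ws = n \<and> set ws \<subseteq> S \<and> sum_list ws = g"
    using gen by (auto simp: fin_sym_generating_set_def)
  from LeastI_ex[OF this] show thesis
    unfolding word_length_def[symmetric] using that by blast
qed

lemma word_length_le: "set ws \<subseteq> S \<Longrightarrow> word_length S (sum_list ws) \<le> length ws"
  unfolding word_length_def by (rule Least_le) blast

lemma word_length_zero [simp]: "word_length S 0 = 0"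
  using word_length_le[of "[]"] by simp

lemma word_length_add: "word_length S (g + h) \<le> word_length S g + word_length S h"
proof -
  obtain as where as: "length as = word_length S g" "set as \<subseteq> S" "sum_list as = g"
    by (rule word_length_word)
  obtain bs where bs: "length bs = word_length S h" "set bs \<subseteq> S" "sum_list bs = h"
    by (rule word_length_word)
  show ?thesis using word_length_le[of "as @ bs"] as bs by simp
qed

lemma uminus_sum_list: "- sum_list ws = sum_list (rev (map uminus ws))" for ws :: "'g list"
  by (induction ws) (simp_all add: minus_add)

lemma word_length_uminus [simp]: "word_length S (- g) = word_length S g"
proof -
  have "word_length S (- g) \<le> word_length S g" for g
  proof -
    obtain ws where ws: "length ws = word_length S g" "set ws \<subseteq> S" "sum_list ws = g"
      by (rule word_length_word)
    then have "set (rev (map uminus ws)) \<subseteq> S" using uminus_S by auto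
    from word_length_le[OF this] ws(1) show ?thesis
      by (simp only: uminus_sum_list[symmetric] ws(3)) simp
  qed
  from this[of g] this[of "- g"] show ?thesis by simp
qed

lemma word_length_split:
  assumes "t \<le> word_length S g"
  obtains a b where "g = a + b" "word_length S a = t" "word_length S b = word_length S g - t"
proof -
  obtain ws where ws: "length ws = word_length S g" "set ws \<subseteq> S" "sum_list ws = g"
    by (rule word_length_word)
  let ?a = "sum_list (take t ws)" and ?b = "sum_list (drop t ws)"
  have g: "g = ?a + ?b"
    by (metis append_take_drop_id sum_list.append ws(3))
  have "set (take t ws) \<subseteq> S" "set (drop t ws) \<subseteq> S"
    using ws(2) set_take_subset[of t ws] set_drop_subset[of t ws] by auto
  from word_length_le[OF this(1)] word_length_le[OF this(2)]
  have "word_length S ?a \<le> t" "word_length S ?b \<le> word_length S g - t"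
    using ws(1) assms by simp_all
  moreover have "word_length S g \<le> word_length S ?a + word_length S ?b"
    using word_length_add[of ?a ?b] unfolding g[symmetric] .
  ultimately have "word_length S ?a = t" "word_length S ?b = word_length S g - t"
    using assms by linarith+
  then show thesis by (rule that[OF g])
qed

text \<open>Padding with the neutral element makes every short element a word of length exactly \<open>R\<close>.\<close>

lemma ball_subset_words:
  "{g. word_length S g \<le> R} \<subseteq> sum_list ` {ws. set ws \<subseteq> insert 0 S \<and> length ws = R}"
proof
  fix g assume "g \<in> {g. word_length S g \<le> R}"
  moreover have "sum_list (replicate n 0) = (0 :: 'g)" for n
    by (induction n) simp_all
  moreover obtain ws where ws: "length ws = word_length S g" "set ws \<subseteq> S" "sum_list ws = g"
    by (rule word_length_word)
  ultimately have "g = sum_list (ws @ replicate (R - length ws) 0)"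
    "length (ws @ replicate (R - length ws) 0) = R"
    "set (ws @ replicate (R - length ws) 0) \<subseteq> insert 0 S"
    by auto
  then show "g \<in> sum_list ` {ws. set ws \<subseteq> insert 0 S \<and> length ws = R}"
    by blast
qed

lemma finite_ball: "finite {g. word_length S g \<le> R}"
  by (rule finite_subset[OF ball_subset_words finite_imageI[OF finite_lists_length_eq]])
    (simp add: finite_S)

lemma card_ball: "card {g. word_length S g \<le> R} \<le> (card S + 1) ^ R"
proof -
  have "card {g. word_length S g \<le> R} \<le> card (sum_list ` {ws. set ws \<subseteq> insert 0 S \<and> length ws = R})"
    by (intro card_mono[OF _ ball_subset_words] finite_imageI finite_lists_length_eq)
      (simp add: finite_S)
  also have "\<dots> \<le> card {ws. set ws \<subseteq> insert 0 S \<and> length ws = R}"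
    by (rule card_image_le) (simp add: finite_S finite_lists_length_eq)
  also have "\<dots> = card (insert 0 S) ^ R"
    by (rule card_lists_length_eq) (simp add: finite_S)
  also have "\<dots> \<le> (card S + 1) ^ R"
    by (rule power_mono) (simp_all add: card_insert_le_m1 card_insert_if finite_S)
  finally show ?thesis .
qed

abbreviation d :: "'g \<Rightarrow> 'g \<Rightarrow> real" where
  "d \<equiv> word_metric S"

lemma d_eq: "d g h = real (word_length S (- g + h))"
  by (simp add: word_metric_def)

lemma d_commute: "d g h = d h g"
  using word_length_uminus[of "- g + h"] by (simp add: d_eq minus_add)

lemma d_triangle: "d g k \<le> d g h + d h k"
  using word_length_add[of "- g + h" "- h + k"]
  by (simp add: d_eq add.assoc flip: of_nat_add)

lemma d_translate [simp]: "d (z + g) (z + h) = d g h"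
  by (simp add: d_eq minus_add add.assoc del: add_uminus_conv_diff)

lemma d_geodesic:
  assumes "real t \<le> d g h"
  obtains p where "d g p = real t" "d p h = d g h - real t"
proof -
  have "t \<le> word_length S (- g + h)" using assms by (simp add: d_eq)
  then obtain a b where ab: "- g + h = a + b" "word_length S a = t"
      "word_length S b = word_length S (- g + h) - t"
    by (rule word_length_split)
  have "h = g + (a + b)" using ab(1) by (metis add.assoc add.left_neutral right_minus)
  then have "- (g + a) + h = b"
    by (simp add: minus_add add.assoc del: add_uminus_conv_diff)
  then show thesis
    using ab assms by (intro that[of "g + a"]) (auto simp: d_eq add.assoc)
qed

end

section \<open>Rotations of words in a hyperbolic group\<close>

locale hyperbolic_group = fin_generated S for S :: "'g::group_add set" +
  fixes \<delta> :: real
  assumes \<delta>_nonneg: "0 \<le> \<delta>"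
    and four_point: "\<And>w x y z. min (gromov_product d w x y) (gromov_product d w y z) - \<delta>
        \<le> gromov_product d w x z"
begin

text \<open>Bisecting a path of length at most \<open>2 ^ m\<close> uses the four-point condition \<open>m\<close> times.\<close>

lemma gromov_product_path:
  fixes \<xi> :: "nat \<Rightarrow> 'g"
  assumes "1 \<le> k" and "k \<le> 2 ^ m"
  shows "\<exists>i<k. gromov_product d w (\<xi> i) (\<xi> (Suc i)) \<le> gromov_product d w (\<xi> 0) (\<xi> k) + real m * \<delta>"
  using assms
proof (induction m arbitrary: k \<xi>)
  case 0
  then have "k = 1" by simp
  then show ?case by auto
next
  case (Suc m)
  let ?G = "gromov_product d w"
  show ?case
  proof (cases "k = 1")
    case True
    then show ?thesis using \<delta>_nonneg by auto
  next
    case False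
    define j where "j = k div 2"
    have j: "1 \<le> j" "j \<le> 2 ^ m" "1 \<le> k - j" "k - j \<le> 2 ^ m" "j < k"
      using Suc.prems False by (auto simp: j_def)
    have "min (?G (\<xi> 0) (\<xi> j)) (?G (\<xi> j) (\<xi> k)) \<le> ?G (\<xi> 0) (\<xi> k) + \<delta>"
      using four_point[of w "\<xi> 0" "\<xi> j" "\<xi> k"] by simp
    then consider "?G (\<xi> 0) (\<xi> j) \<le> ?G (\<xi> 0) (\<xi> k) + \<delta>" | "?G (\<xi> j) (\<xi> k) \<le> ?G (\<xi> 0) (\<xi> k) + \<delta>"
      by linarith
    then show ?thesis
    proof cases
      case 1
      obtain i where "i < j" "?G (\<xi> i) (\<xi> (Suc i)) \<le> ?G (\<xi> 0) (\<xi> j) + real m * \<delta>"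
        using Suc.IH[OF j(1,2), of \<xi>] by blast
      then show ?thesis using 1 j by (intro exI[of _ i]) (auto simp: distrib_right)
    next
      case 2
      obtain i where "i < k - j" "?G (\<xi> (j + i)) (\<xi> (j + Suc i)) \<le> ?G (\<xi> j) (\<xi> k) + real m * \<delta>"
        using Suc.IH[OF j(3,4), of "\<lambda>i. \<xi> (j + i)"] j by auto
      then show ?thesis using 2 j by (intro exI[of _ "j + i"]) (auto simp: distrib_right)
    qed
  qed
qed

text \<open>
  Let \<open>y = h + x - h\<close>, so that \<open>y\<close> moves \<open>h\<close> by the word length of \<open>x\<close>. The geodesic from \<open>h\<close>
  to \<open>0\<close> and its translate, from \<open>y + h\<close> to \<open>y\<close>, stay close for as long as the Gromov product of \<open>0\<close>
  and \<open>y\<close> at \<open>h\<close>. At the point \<open>p\<close> where they diverge, \<open>y\<close> still has bounded displacement, and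
  \<open>p\<close> is close to every geodesic from \<open>0\<close> to \<open>y\<close>.
\<close>

lemma conjugate_branch_point:
  fixes x h :: 'g
  defines "y \<equiv> h + x - h" and "c \<equiv> real (word_length S x)"
  shows "\<exists>p. d p (y + p) \<le> 3 * c + 4 * \<delta> \<and> gromov_product d p 0 y \<le> 2 * c + 2 * \<delta> + 1"
proof -
  let ?G = "gromov_product d"
  define T where "T = ?G h 0 y"
  define t where "t = nat \<lfloor>T\<rfloor>"
  have yh: "y + h = h + x" by (simp add: y_def)
  have c: "d h (y + h) = c" by (simp add: yh d_eq c_def add.assoc)
  have hy: "d (y + h) y = d h 0" using d_translate[of y h 0] by simp
  have T0: "0 \<le> T"
    using d_triangle[of 0 y h] by (simp add: T_def gromov_product_def d_commute[of h 0])
  have T1: "T \<le> d h 0"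
    using d_triangle[of h y 0] by (simp add: T_def gromov_product_def)
  have t: "real t \<le> T" "T \<le> real t + 1"
    using T0 by (simp_all add: t_def of_nat_nat)
  obtain p where p: "d h p = real t" "d p 0 = d h 0 - real t"
    by (rule d_geodesic[of t h 0]) (use t T1 in auto)
  have yp: "d (y + h) (y + p) = real t" using p(1) by simp
  have py: "d (y + p) y = d h 0 - real t" using d_translate[of y p 0] p(2) by simp
  have tri1: "d h (y + p) \<le> c + real t" "real t \<le> c + d h (y + p)"
    using d_triangle[of h "y + p" "y + h"] d_triangle[of "y + h" "y + p" h] c yp
    by (simp_all add: d_commute[of "y + h" h])
  have tri2: "d h 0 \<le> c + d h y"
    using d_triangle[of "y + h" y h] c hy by (simp add: d_commute[of "y + h" h])
  have "?G h p 0 = real t" by (simp add: gromov_product_def p)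
  moreover have "real t - c \<le> ?G h y (y + p)"
    using tri1 tri2 py by (simp add: gromov_product_def d_commute[of y "y + p"])
  moreover have "min (?G h 0 y) (?G h y (y + p)) - \<delta> \<le> ?G h 0 (y + p)"
    "min (?G h p 0) (?G h 0 (y + p)) - \<delta> \<le> ?G h p (y + p)"
    by (rule four_point)+
  moreover have "0 \<le> c" by (simp add: c_def)
  ultimately have "real t - c - 2 * \<delta> \<le> ?G h p (y + p)"
    using t(1) \<delta>_nonneg unfolding T_def[symmetric] by linarith
  then have D: "d p (y + p) \<le> 3 * c + 4 * \<delta>"
    using tri1 p(1) by (simp add: gromov_product_def)
  have "d p y \<le> d p (y + p) + d (y + p) y" by (rule d_triangle)
  moreover have "2 * T = d h 0 + d h y - d 0 y" by (simp add: T_def gromov_product_def)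
  ultimately have "?G p 0 y \<le> 2 * c + 2 * \<delta> + 1"
    using D py p(2) tri2 t by (simp add: gromov_product_def)
  with D show ?thesis by blast
qed

text \<open>
  The partial products of a word representing \<open>y\<close> form a path from \<open>0\<close> to \<open>y\<close>, which by
  bisection comes logarithmically close to the branch point. The rotation starting at the partial
  product \<open>z\<close> represents \<open>- z + y + z\<close>, whose length is the displacement of \<open>z\<close> under \<open>y\<close>.
\<close>

lemma short_rotation:
  fixes x :: 'g
  assumes conj: "sum_list gs \<in> conjugacy_class x"
    and len: "length gs \<le> 2 ^ m" and letters: "\<And>g. g \<in> set gs \<Longrightarrow> real (word_length S g) \<le> l"
    and "0 \<le> l"
  shows "\<exists>i\<le>length gs. real (word_length S (sum_list (rotation i gs)))
    \<le> 7 * real (word_length S x) + 8 * \<delta> + 2 + 2 * l + 2 * real m * \<delta>"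
proof (cases "gs = []")
  case True
  then show ?thesis using \<delta>_nonneg \<open>0 \<le> l\<close> by simp
next
  case False
  define c where "c = real (word_length S x)"
  define y where "y = sum_list gs"
  define \<xi> where "\<xi> i = sum_list (take i gs)" for i
  obtain h where h: "y = h + x - h" using conj by (auto simp: conjugacy_class_def y_def)
  obtain p where p: "d p (y + p) \<le> 3 * c + 4 * \<delta>" "gromov_product d p 0 y \<le> 2 * c + 2 * \<delta> + 1"
    using conjugate_branch_point[of h x] unfolding h c_def by blast
  have "1 \<le> length gs" using False by (simp add: Suc_le_eq)
  from gromov_product_path[OF this len, of p \<xi>] obtain i where i: "i < length gs"
      "gromov_product d p (\<xi> i) (\<xi> (Suc i)) \<le> gromov_product d p 0 y + real m * \<delta>"
    by (auto simp: \<xi>_def y_def)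
  have "\<xi> (Suc i) = \<xi> i + gs ! i"
    using i(1) by (simp add: \<xi>_def take_Suc_conv_app_nth)
  then have "d (\<xi> i) (\<xi> (Suc i)) \<le> l"
    using letters[of "gs ! i"] i(1) by (simp add: d_eq add.assoc)
  then have "d p (\<xi> i) - l \<le> gromov_product d p (\<xi> i) (\<xi> (Suc i))"
    using d_triangle[of p "\<xi> i" "\<xi> (Suc i)"]
    by (simp add: gromov_product_def d_commute[of "\<xi> (Suc i)" "\<xi> i"])
  then have "d p (\<xi> i) \<le> 2 * c + 2 * \<delta> + 1 + real m * \<delta> + l"
    using i(2) p(2) by linarith
  moreover have "d (\<xi> i) (y + \<xi> i) \<le> d (\<xi> i) p + d p (y + p) + d (y + p) (y + \<xi> i)"
    using d_triangle[of "\<xi> i" "y + \<xi> i" p] d_triangle[of p "y + \<xi> i" "y + p"] by linarith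
  ultimately have "d (\<xi> i) (y + \<xi> i) \<le> 7 * c + 8 * \<delta> + 2 + 2 * l + 2 * real m * \<delta>"
    using p(1) by (simp add: d_commute[of "\<xi> i" p])
  moreover have "sum_list (rotation i gs) = - \<xi> i + (y + \<xi> i)"
  proof -
    have "y = \<xi> i + sum_list (drop i gs)"
      by (metis y_def \<xi>_def append_take_drop_id sum_list.append)
    then show ?thesis by (simp add: \<xi>_def add.assoc)
  qed
  ultimately show ?thesis using i(1) by (intro exI[of _ i]) (simp add: d_eq c_def)
qed

end

section \<open>Unconditional completions of the group ring\<close>

locale unconditional_completion =
  fixes scaleC :: "complex \<Rightarrow> 'a::{ring_1,t2_space} \<Rightarrow> 'a"
    and \<iota> :: "('g::group_add \<Rightarrow>\<^sub>0 complex) \<Rightarrow> 'a"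
    and q :: "nat \<Rightarrow> 'a \<Rightarrow> real"
  assumes linear: "Vector_Spaces.linear gr_scale scaleC \<iota>"
    and \<iota>_times: "\<iota> (a * b) = \<iota> a * \<iota> b"
    and \<iota>_one: "\<iota> 1 = 1"
    and inj: "inj \<iota>"
    and q_seminorm: "seminorm scaleC (q k)"
    and q_unconditional: "unconditional (q k \<circ> \<iota>)"
    and topology: "topology_given_by q"
    and complete: "sequentially_complete TYPE('a)"
begin

sublocale \<iota>: Vector_Spaces.linear gr_scale scaleC \<iota>
  by (rule linear)

lemma q_nonneg: "0 \<le> q k a"
  using q_seminorm[of k] by (simp add: seminorm_def)

lemma q_triangle: "q k (a + b) \<le> q k a + q k b"
  using q_seminorm[of k] by (simp add: seminorm_def)

lemma q_scale: "q k (scaleC c a) = cmod c * q k a"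
  using q_seminorm[of k] by (simp add: seminorm_def)

lemma q_zero [simp]: "q k 0 = 0"
  using q_scale[of k 0 0] by simp

lemma q_minus_commute: "q k (a - b) = q k (b - a)"
  using q_scale[of k "-1" "a - b"] by (simp add: \<iota>.vs2.scale_minus_left)

lemma q_\<iota>_seminorm: "seminorm gr_scale (q k \<circ> \<iota>)"
  by (simp add: seminorm_def q_nonneg q_triangle q_scale \<iota>.add \<iota>.scale)

lemma open_q_ball: "open {b. q k (b - a) < e}"
proof -
  have "\<exists>F \<epsilon>. finite F \<and> \<epsilon> > 0 \<and> {c. \<forall>j\<in>F. q j (c - b) < \<epsilon>} \<subseteq> {b. q k (b - a) < e}"
    if "q k (b - a) < e" for b
  proof (intro exI[of _ "{k}"] exI[of _ "e - q k (b - a)"] conjI subsetI)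
    fix c assume "c \<in> {c. \<forall>j\<in>{k}. q j (c - b) < e - q k (b - a)}"
    then show "c \<in> {b. q k (b - a) < e}"
      using q_triangle[of k "c - b" "b - a"] by simp
  qed (use that in auto)
  then show ?thesis
    using topology unfolding topology_given_by_def by blast
qed

lemma open_q_nbhd:
  assumes "open W" and "a \<in> W"
  obtains F \<epsilon> where "finite F" "0 < \<epsilon>" "\<forall>b. (\<forall>k\<in>F. q k (b - a) < \<epsilon>) \<longrightarrow> b \<in> W"
  using assms topology unfolding topology_given_by_def
  by (smt (verit, best) mem_Collect_eq subset_iff)

lemma tendsto_q_iff: "u \<longlonglongrightarrow> a \<longleftrightarrow> (\<forall>k. (\<lambda>i. q k (u i - a)) \<longlonglongrightarrow> 0)"
proof
  assume u: "u \<longlonglongrightarrow> a"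
  show "\<forall>k. (\<lambda>i. q k (u i - a)) \<longlonglongrightarrow> 0"
  proof (intro allI LIMSEQ_I)
    fix k and e :: real assume "0 < e"
    then have "eventually (\<lambda>i. u i \<in> {b. q k (b - a) < e}) sequentially"
      by (intro topological_tendstoD[OF u open_q_ball]) simp
    then show "\<exists>N. \<forall>i\<ge>N. norm (q k (u i - a) - 0) < e"
      by (simp add: eventually_sequentially q_nonneg)
  qed
next
  assume lim: "\<forall>k. (\<lambda>i. q k (u i - a)) \<longlonglongrightarrow> 0"
  show "u \<longlonglongrightarrow> a"
  proof (rule topological_tendstoI)
    fix W assume "open W" "a \<in> W"
    then obtain F \<epsilon> where F: "finite F" "0 < \<epsilon>" "\<forall>b. (\<forall>k\<in>F. q k (b - a) < \<epsilon>) \<longrightarrow> b \<in> W"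
      by (rule open_q_nbhd)
    have "eventually (\<lambda>i. q k (u i - a) < \<epsilon>) sequentially" for k
      by (rule order_tendstoD(2)[OF lim[rule_format] F(2)])
    then have "eventually (\<lambda>i. \<forall>k\<in>F. q k (u i - a) < \<epsilon>) sequentially"
      by (simp add: eventually_ball_finite F(1))
    then show "eventually (\<lambda>i. u i \<in> W) sequentially"
      by (rule eventually_mono) (use F(3) in blast)
  qed
qed

lemma q_cauchy_converges:
  assumes "\<And>k e. 0 < e \<Longrightarrow> \<exists>M. \<forall>i\<ge>M. \<forall>j\<ge>M. q k (u i - u j) < e"
  shows "\<exists>a. u \<longlonglongrightarrow> a"
proof -
  have "\<exists>M. \<forall>i\<ge>M. \<forall>j\<ge>M. u i - u j \<in> W" if W: "open W" "0 \<in> W" for W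
  proof -
    from W obtain F \<epsilon> where F: "finite F" "0 < \<epsilon>" "\<forall>b. (\<forall>k\<in>F. q k (b - 0) < \<epsilon>) \<longrightarrow> b \<in> W"
      by (rule open_q_nbhd)
    obtain M where M: "\<And>k. \<forall>i\<ge>M k. \<forall>j\<ge>M k. q k (u i - u j) < \<epsilon>"
      using assms[OF F(2)] by metis
    have "M k \<le> (\<Sum>k\<in>F. M k)" if "k \<in> F" for k
      using that F(1) by (intro member_le_sum) auto
    then have "\<forall>i\<ge>sum M F. \<forall>j\<ge>sum M F. u i - u j \<in> W"
      using M F(3) by (simp, meson order_trans)
    then show ?thesis by blast
  qed
  then show ?thesis
    using complete unfolding sequentially_complete_def by blast
qed

lemma q_separating: "a \<noteq> 0 \<Longrightarrow> \<exists>k. 0 < q k a"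
proof (rule ccontr)
  assume "a \<noteq> 0" and "\<nexists>k. 0 < q k a"
  then have zero: "q k a = 0" for k
    using q_nonneg[of k a] by (metis less_eq_real_def)
  obtain W where W: "open W" "0 \<in> W" "a \<notin> W"
    using \<open>a \<noteq> 0\<close> by (metis t1_space)
  from W(1,2) obtain F \<epsilon> where "0 < \<epsilon>" "\<forall>b. (\<forall>k\<in>F. q k (b - 0) < \<epsilon>) \<longrightarrow> b \<in> W"
    by (rule open_q_nbhd)
  then have "a \<in> W" using zero by simp
  with W(3) show False by blast
qed

lemma cmod_coef_le_q: "\<exists>k. \<exists>C>0. \<forall>a. cmod (coef a g) \<le> C * q k (\<iota> a)"
proof -
  have "gr_monom g 1 \<noteq> (0 :: 'g \<Rightarrow>\<^sub>0 complex)"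
    by (metis lookup_single_eq lookup_zero zero_neq_one)
  then have "\<iota> (gr_monom g 1) \<noteq> 0"
    using inj \<iota>.zero by (metis injD)
  then obtain k where k: "0 < q k (\<iota> (gr_monom g 1))"
    using q_separating by blast
  have "cmod (coef a g) * q k (\<iota> (gr_monom g 1)) \<le> q k (\<iota> a)" for a
  proof -
    have "cmod (coef a g) * q k (\<iota> (gr_monom g 1)) = q k (\<iota> (gr_monom g (coef a g)))"
      using q_scale[of k "coef a g" "\<iota> (gr_monom g 1)"]
      by (simp add: \<iota>.scale[symmetric] gr_scale_monom)
    also have "\<dots> \<le> q k (\<iota> a)"
      using q_unconditional[of k] by (simp add: unconditional_def lookup_single when_def)
    finally show ?thesis .
  qed
  then have "cmod (coef a g) \<le> (1 / q k (\<iota> (gr_monom g 1))) * q k (\<iota> a)" for a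
    using k by (simp add: field_simps)
  then show ?thesis using k by (intro exI[of _ k] exI[of _ "1 / q k (\<iota> (gr_monom g 1))"]) simp
qed

lemma scaled_into_nbhd:
  assumes "open W" and "0 \<in> W" and "finite G"
  obtains e where "0 < e" "e \<le> 1" "\<And>a. a \<in> G \<Longrightarrow> \<iota> (gr_scale (complex_of_real e) a) \<in> W"
proof -
  from assms(1,2) obtain F \<epsilon> where F: "finite F" "0 < \<epsilon>" "\<forall>b. (\<forall>k\<in>F. q k (b - 0) < \<epsilon>) \<longrightarrow> b \<in> W"
    by (rule open_q_nbhd)
  define M where "M = 1 + (\<Sum>(a, k)\<in>G \<times> F. q k (\<iota> a))"
  have M: "1 \<le> M" by (auto simp: M_def intro!: sum_nonneg q_nonneg)
  define e where "e = min 1 (\<epsilon> / M)"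
  have e: "0 < e" "e \<le> 1" using M F(2) by (auto simp: e_def)
  have "\<iota> (gr_scale (complex_of_real e) a) \<in> W" if a: "a \<in> G" for a
  proof (rule F(3)[rule_format])
    fix k assume k: "k \<in> F"
    have "(\<lambda>(a, k). q k (\<iota> a)) (a, k) \<le> (\<Sum>(a, k)\<in>G \<times> F. q k (\<iota> a))"
      using a k F(1) assms(3) by (intro member_le_sum) (auto simp: q_nonneg)
    then have less: "q k (\<iota> a) < M" by (simp add: M_def)
    have "e * q k (\<iota> a) < e * M" using less e(1) by simp
    also have "\<dots> \<le> (\<epsilon> / M) * M" using M by (intro mult_right_mono) (auto simp: e_def)
    also have "\<dots> = \<epsilon>" using M by simp
    finally show "q k (\<iota> (gr_scale (complex_of_real e) a) - 0) < \<epsilon>"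
      using e(1) by (simp add: \<iota>.scale q_scale)
  qed
  with e show thesis by (rule that)
qed

lemma \<iota>_prod_list_in_power: "set as \<subseteq> F \<Longrightarrow> \<iota> (prod_list as) \<in> (\<iota> ` F) ^ length as"
  by (induction as) (auto simp: \<iota>_one \<iota>_times)

text \<open>
  The semigroup generated by a finite subset of an open unit ball has compact closure, which is
  covered by finitely many of the open sublevel sets of a seminorm.
\<close>

lemma words_bounded:
  assumes U: "open_unit_ball U" and F: "finite F" "\<iota> ` F \<subseteq> U"
  shows "\<exists>M. \<forall>as. set as \<subseteq> F \<longrightarrow> q k (\<iota> (prod_list as)) \<le> M"
proof -
  let ?Z = "closure (\<Union>n\<in>{1::nat..}. (\<iota> ` F) ^ n)"
  have "compact ?Z"
    using U F by (simp add: open_unit_ball_def finite_imp_compact)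
  moreover have "open {b. q k (b - 0) < real n}" for n :: nat
    by (rule open_q_ball)
  moreover have "?Z \<subseteq> (\<Union>n\<in>UNIV. {b. q k (b - 0) < real n})"
    using reals_Archimedean2 by auto
  ultimately obtain N where N: "finite N" "?Z \<subseteq> (\<Union>n\<in>N. {b. q k (b - 0) < real n})"
    by (rule compactE_image)
  define M where "M = q k 1 + real (\<Sum>n\<in>N. n)"
  have "q k (\<iota> (prod_list as)) \<le> M" if as: "set as \<subseteq> F" for as
  proof (cases "as = []")
    case True
    then show ?thesis by (simp add: M_def \<iota>_one sum_nonneg)
  next
    case False
    then have "1 \<le> length as" by (simp add: Suc_le_eq)
    then have "\<iota> (prod_list as) \<in> (\<Union>n\<in>{1::nat..}. (\<iota> ` F) ^ n)"
      using \<iota>_prod_list_in_power[OF as] by auto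
    then have "\<iota> (prod_list as) \<in> ?Z"
      by (rule subsetD[OF closure_subset])
    from subsetD[OF N(2) this] obtain n where n: "n \<in> N" "q k (\<iota> (prod_list as)) < real n"
      by auto
    moreover have "n \<le> (\<Sum>n\<in>N. n)" using n(1) N(1) by (intro member_le_sum) auto
    ultimately show ?thesis using q_nonneg[of k 1] unfolding M_def by linarith
  qed
  then show ?thesis by blast
qed

lemma word_coefs_bounded:
  assumes "open_unit_ball U" and "finite F" and "\<iota> ` F \<subseteq> U"
  shows "\<exists>M. \<forall>as. set as \<subseteq> F \<longrightarrow> cmod (coef (prod_list as) g) \<le> M"
proof -
  obtain k C where C: "0 < C" "\<And>a. cmod (coef a g) \<le> C * q k (\<iota> a)"
    using cmod_coef_le_q by blast
  obtain M where "\<And>as. set as \<subseteq> F \<Longrightarrow> q k (\<iota> (prod_list as)) \<le> M"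
    using words_bounded[OF assms] by blast
  then have "cmod (coef (prod_list as) g) \<le> C * M" if "set as \<subseteq> F" for as
    using C(1) C(2)[of "prod_list as"] that by (meson mult_left_mono less_imp_le order_trans)
  then show ?thesis by blast
qed

text \<open>
  If \<open>\<iota> a\<close> lies in \<open>U\<close>, then so do \<open>|a|\<close> and a fixed small multiple of the monomial of \<open>- g\<close>. The
  powers of the product of these two are bounded, while their coefficient at \<open>0\<close> grows at least like
  the powers of a fixed multiple of \<open>|a g|\<close>.
\<close>

lemma unit_ball_coefs_bounded:
  assumes U: "open_unit_ball U" and abs: "\<And>a. \<iota> a \<in> U \<Longrightarrow> \<iota> (gr_abs a) \<in> U"
  shows "\<exists>M. \<forall>a. \<iota> a \<in> U \<longrightarrow> cmod (coef a g) \<le> M"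
proof -
  obtain e where e: "0 < e" "\<iota> (gr_scale (complex_of_real e) (gr_monom (- g) 1)) \<in> U"
    using scaled_into_nbhd[of U "{gr_monom (- g) 1}"] U
    by (auto simp: open_unit_ball_def)
  have "cmod (coef a g) \<le> 1 / e" if a: "\<iota> a \<in> U" for a
  proof (rule ccontr)
    define r where "r = cmod (coef a g)"
    define b where "b = gr_monom (- g) (complex_of_real e)"
    assume "\<not> cmod (coef a g) \<le> 1 / e"
    then have big: "1 < r * e" using e(1) by (simp add: r_def field_simps)
    have "finite {gr_abs a, b}" "\<iota> ` {gr_abs a, b} \<subseteq> U"
      using abs[OF a] e(2) by (simp_all add: b_def gr_scale_monom)
    from word_coefs_bounded[OF U this, of 0] obtain M where
      M: "\<And>as. set as \<subseteq> {gr_abs a, b} \<Longrightarrow> cmod (coef (prod_list as) 0) \<le> M"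
      by blast
    have le: "(r * e) ^ j \<le> M" for j
    proof -
      have "majorised (gr_monom g (complex_of_real r)) (gr_abs a)"
        by (simp add: majorised_def lookup_single when_def r_def)
      moreover have "nonneg_coefs b"
        unfolding b_def by (rule nonneg_monom) (use e in simp)
      ultimately have "majorised (gr_monom g (complex_of_real r) * b) (gr_abs a * b)"
        by (rule majorised_times)
      then have base: "majorised (gr_monom 0 (complex_of_real (r * e))) (gr_abs a * b)"
        by (simp add: b_def mult_single)
      have "majorised (gr_monom 0 (complex_of_real ((r * e) ^ j))) ((gr_abs a * b) ^ j)"
      proof (induction j)
        case 0
        then show ?case using nonneg_one by (simp add: majorised_def lookup_one lookup_single)
      next
        case (Suc j)
        from majorised_times[OF base this] show ?case by (simp add: mult_single)
      qed
      then have "cmod (coef (gr_monom 0 (complex_of_real ((r * e) ^ j))) (0 :: 'g))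
          \<le> Re (coef ((gr_abs a * b) ^ j) 0)"
        unfolding majorised_def by blast
      then have "(r * e) ^ j \<le> cmod (coef ((gr_abs a * b) ^ j) 0)"
        using complex_Re_le_cmod[of "coef ((gr_abs a * b) ^ j) 0"]
        unfolding lookup_single_eq norm_of_real by linarith
      also have "(gr_abs a * b) ^ j = prod_list (concat (replicate j [gr_abs a, b]))"
        by (induction j) (simp_all add: mult.assoc)
      also have "cmod (coef (prod_list (concat (replicate j [gr_abs a, b]))) 0) \<le> M"
        by (rule M) (auto simp: set_replicate_conv_if)
      finally show ?thesis .
    qed
    obtain j where "M < (r * e) ^ j"
      using real_arch_pow[OF big] by blast
    with le[of j] show False by simp
  qed
  then show ?thesis by blast
qed

section \<open>Exponential decay of words\<close>

text \<open>
  The elements of \<open>U\<close> supported in a finite set \<open>B\<close> have bounded coefficients, so their absolute values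
  have a finite net inside \<open>U\<close>, up to a small multiple of the sum of all monomials in \<open>B\<close>. That error is
  absorbed by a further element of \<open>U\<close>, a fixed multiple of this sum. Choosing the mesh fine enough
  keeps the total weight below \<open>1\<close> after scaling by \<open>n / (n + 1)\<close>; the value \<open>(2 n + 1) / (2 n + 2)\<close>
  is \<open>n / (n + 1) * (1 + 1 / (2 n))\<close>. In this way finitely many elements of \<open>U\<close> majorise all of the
  possibly noncompact set \<open>T_n\<close>.
\<close>

lemma finite_majorants:
  fixes n :: nat and B :: "'g set"
  assumes U: "open_unit_ball U" and abs: "\<And>a. \<iota> a \<in> U \<Longrightarrow> \<iota> (gr_abs a) \<in> U"
    and "finite B" and "1 \<le> n"
  shows "\<exists>F. finite F \<and> \<iota> ` F \<subseteq> U \<and> (\<forall>a\<in>F. nonneg_coefs a) \<and>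
    (\<forall>t. Poly_Mapping.keys t \<subseteq> B \<longrightarrow>
       \<iota> t \<in> scaleC (complex_of_real (real n / real (n + 1))) ` U \<longrightarrow>
       (\<exists>a\<in>F. \<exists>b\<in>F. \<exists>\<alpha>\<ge>0. \<exists>\<beta>\<ge>0. \<alpha> + \<beta> = (2 * real n + 1) / (2 * real n + 2) \<and>
         majorised t (gr_scale (complex_of_real \<alpha>) a + gr_scale (complex_of_real \<beta>) b)))"
proof -
  define s :: "'g \<Rightarrow>\<^sub>0 complex" where "s = (\<Sum>g\<in>B. gr_monom g 1)"
  have coef_s: "coef s g = (if g \<in> B then 1 else 0)" for g
    using \<open>finite B\<close> by (simp add: s_def lookup_sum lookup_single when_def)
  obtain \<epsilon> where \<epsilon>: "0 < \<epsilon>" "\<iota> (gr_scale (complex_of_real \<epsilon>) s) \<in> U"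
    using scaled_into_nbhd[of U "{s}"] U by (auto simp: open_unit_ball_def)
  define \<eta> where "\<eta> = \<epsilon> / (2 * real n)"
  have \<eta>: "0 < \<eta>" using \<epsilon> \<open>1 \<le> n\<close> by (simp add: \<eta>_def)
  define E where "E = {a. Poly_Mapping.keys a \<subseteq> B \<and> \<iota> a \<in> U \<and> nonneg_coefs a}"
  obtain M where M: "\<And>g a. \<iota> a \<in> U \<Longrightarrow> cmod (coef a g) \<le> M g"
    using unit_ball_coefs_bounded[OF U abs] by metis
  define level where "level a = restrict (\<lambda>g. nat \<lfloor>Re (coef a g) / \<eta>\<rfloor>) B" for a
  have "level a \<in> (\<Pi>\<^sub>E g\<in>B. {..nat \<lfloor>M g / \<eta>\<rfloor>})" if "a \<in> E" for a
  proof -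
    have "Re (coef a g) / \<eta> \<le> M g / \<eta>" for g
      using M[of a g] that complex_Re_le_cmod[of "coef a g"] \<eta>
      by (intro divide_right_mono) (auto simp: E_def)
    then show ?thesis by (auto simp: level_def intro!: nat_mono floor_mono)
  qed
  then have "level ` E \<subseteq> (\<Pi>\<^sub>E g\<in>B. {..nat \<lfloor>M g / \<eta>\<rfloor>})" by blast
  then have "finite (level ` E)"
    by (rule finite_subset) (simp add: finite_PiE \<open>finite B\<close>)
  then obtain E' where E': "E' \<subseteq> E" "finite E'" "level ` E = level ` E'"
    using finite_subset_image[of "level ` E" level E] by auto
  have net: "\<exists>a\<in>E'. \<forall>g\<in>B. Re (coef b g) \<le> Re (coef a g) + \<eta>" if "b \<in> E" for b
  proof -
    obtain a where a: "a \<in> E'" "level b = level a" using E'(3) \<open>b \<in> E\<close> by (metis imageE imageI)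
    have "Re (coef b g) \<le> Re (coef a g) + \<eta>" if "g \<in> B" for g
    proof -
      have "0 \<le> Re (coef a g) / \<eta>" "0 \<le> Re (coef b g) / \<eta>"
        using a(1) E'(1) \<open>b \<in> E\<close> \<eta> by (auto simp: E_def nonneg_coefs_Re)
      moreover have "nat \<lfloor>Re (coef b g) / \<eta>\<rfloor> = nat \<lfloor>Re (coef a g) / \<eta>\<rfloor>"
        using fun_cong[OF a(2), of g] that by (simp add: level_def)
      ultimately have "Re (coef b g) / \<eta> \<le> Re (coef a g) / \<eta> + 1"
        by linarith
      then show ?thesis using \<eta> by (simp add: field_simps)
    qed
    with a(1) show ?thesis by blast
  qed
  define F where "F = insert (gr_scale (complex_of_real \<epsilon>) s) E'"
  have nonneg_s: "nonneg_coefs (gr_scale (complex_of_real \<epsilon>) s)"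
    using \<epsilon>(1) by (simp add: majorised_def coef_s)
  have major: "\<exists>a\<in>F. \<exists>b\<in>F. \<exists>\<alpha>\<ge>0. \<exists>\<beta>\<ge>0. \<alpha> + \<beta> = (2 * real n + 1) / (2 * real n + 2) \<and>
      majorised t (gr_scale (complex_of_real \<alpha>) a + gr_scale (complex_of_real \<beta>) b)"
    if t: "Poly_Mapping.keys t \<subseteq> B" "\<iota> t \<in> scaleC (complex_of_real (real n / real (n + 1))) ` U" for t
  proof -
    define \<mu> where "\<mu> = real n / real (n + 1)"
    have \<mu>: "0 < \<mu>" using \<open>1 \<le> n\<close> by (simp add: \<mu>_def)
    obtain u where u: "u \<in> U" "\<iota> t = scaleC (complex_of_real \<mu>) u"
      using t(2) unfolding \<mu>_def by blast
    define t' where "t' = gr_scale (complex_of_real (1 / \<mu>)) t"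
    have "\<iota> t' = scaleC (complex_of_real (1 / \<mu>) * complex_of_real \<mu>) u"
      by (simp only: t'_def \<iota>.scale u(2) \<iota>.vs2.scale_scale)
    also have "\<dots> = u" using \<mu> by simp
    finally have "\<iota> t' \<in> U" using u(1) by simp
    then have "\<iota> (gr_abs t') \<in> U" by (rule abs)
    moreover have "Poly_Mapping.keys (gr_abs t') \<subseteq> B"
      using t(1) by (auto simp: t'_def in_keys_iff)
    ultimately have "gr_abs t' \<in> E" by (simp add: E_def)
    from net[OF this] obtain a where a: "a \<in> E'" and
      close: "\<And>g. g \<in> B \<Longrightarrow> cmod (coef t' g) \<le> Re (coef a g) + \<eta>"
      by auto
    have a_nonneg: "nonneg_coefs a" using a E'(1) by (auto simp: E_def)
    define \<beta> where "\<beta> = \<mu> * \<eta> / \<epsilon>"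
    have "majorised t (gr_scale (complex_of_real \<mu>) a
        + gr_scale (complex_of_real \<beta>) (gr_scale (complex_of_real \<epsilon>) s))"
      unfolding majorised_def
    proof
      fix g
      have "cmod (coef t g) \<le> \<mu> * Re (coef a g) + (if g \<in> B then \<mu> * \<eta> else 0)"
      proof (cases "g \<in> B")
        case True
        have "cmod (coef t g) = \<mu> * cmod (coef t' g)"
          using \<mu> by (simp add: t'_def norm_mult norm_divide)
        also have "\<dots> \<le> \<mu> * (Re (coef a g) + \<eta>)"
          using close[OF True] \<mu> by simp
        finally show ?thesis using True by (simp add: distrib_left)
      next
        case False
        then have "coef t g = 0" using t(1) by (auto simp: in_keys_iff)
        then show ?thesis using False \<mu> nonneg_coefs_Re[OF a_nonneg, of g] by simp
      qed
      then show "Im (coef (gr_scale (complex_of_real \<mu>) a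
            + gr_scale (complex_of_real \<beta>) (gr_scale (complex_of_real \<epsilon>) s)) g) = 0 \<and>
          cmod (coef t g) \<le> Re (coef (gr_scale (complex_of_real \<mu>) a
            + gr_scale (complex_of_real \<beta>) (gr_scale (complex_of_real \<epsilon>) s)) g)"
        using a_nonneg \<epsilon>(1) by (auto simp: lookup_add coef_s \<beta>_def majorised_def split: if_splits)
    qed
    moreover have "\<mu> + \<beta> = (2 * real n + 1) / (2 * real n + 2)"
    proof -
      have "\<mu> + \<beta> = \<mu> * (1 + 1 / (2 * real n))"
        using \<epsilon>(1) by (simp add: \<beta>_def \<eta>_def distrib_left)
      also have "\<dots> = (2 * real n + 1) / (2 * real n + 2)"
        using \<open>1 \<le> n\<close> by (simp add: \<mu>_def divide_simps)
      finally show ?thesis .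
    qed
    moreover have "0 \<le> \<mu>" "0 \<le> \<beta>" using \<mu> \<eta> \<epsilon>(1) by (simp_all add: \<beta>_def)
    ultimately show ?thesis using a unfolding F_def by blast
  qed
  have "finite F" "\<iota> ` F \<subseteq> U" "\<forall>a\<in>F. nonneg_coefs a"
    using E' \<epsilon>(2) nonneg_s by (auto simp: F_def E_def)
  with major show ?thesis by blast
qed

end

text \<open>Each factor of a word is replaced by its majorant, and the resulting sum is expanded.\<close>

lemma word_decay:
  fixes p :: "('g::group_add \<Rightarrow>\<^sub>0 complex) \<Rightarrow> real"
  assumes p: "seminorm gr_scale p" "unconditional p" and "0 \<le> \<theta>"
    and F: "\<And>a. a \<in> F \<Longrightarrow> nonneg_coefs a"
    and words: "\<And>as. set as \<subseteq> F \<Longrightarrow> p (prod_list as) \<le> M"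
    and T: "\<And>t. t \<in> T \<Longrightarrow> \<exists>a\<in>F. \<exists>b\<in>F. \<exists>\<alpha>\<ge>0. \<exists>\<beta>\<ge>0. \<alpha> + \<beta> = \<theta> \<and>
      majorised t (gr_scale (complex_of_real \<alpha>) a + gr_scale (complex_of_real \<beta>) b)"
    and ts: "set ts \<subseteq> T"
  shows "p (prod_list (map gr_abs ts)) \<le> \<theta> ^ length ts * M"
proof -
  have "p (prod_list as * prod_list (map gr_abs ts)) \<le> \<theta> ^ length ts * M" if "set as \<subseteq> F" for as
    using ts that
  proof (induction ts arbitrary: as)
    case Nil
    then show ?case using words by simp
  next
    case (Cons t ts)
    let ?A = "prod_list as" and ?R = "prod_list (map gr_abs ts)"
    obtain a b \<alpha> \<beta> where ab: "a \<in> F" "b \<in> F" "0 \<le> \<alpha>" "0 \<le> \<beta>" "\<alpha> + \<beta> = \<theta>"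
      and "majorised t (gr_scale (complex_of_real \<alpha>) a + gr_scale (complex_of_real \<beta>) b)"
      using T[of t] Cons.prems(1) by auto
    then have "majorised (gr_abs t) (gr_scale (complex_of_real \<alpha>) a + gr_scale (complex_of_real \<beta>) b)"
      by (simp add: majorised_def)
    then have "majorised (?A * (gr_abs t * ?R))
        (?A * ((gr_scale (complex_of_real \<alpha>) a + gr_scale (complex_of_real \<beta>) b) * ?R))"
      using Cons.prems(2) F by (intro majorised_times nonneg_prod_list) auto
    also have "?A * ((gr_scale (complex_of_real \<alpha>) a + gr_scale (complex_of_real \<beta>) b) * ?R) =
        gr_scale (complex_of_real \<alpha>) (prod_list (as @ [a]) * ?R)
        + gr_scale (complex_of_real \<beta>) (prod_list (as @ [b]) * ?R)"
      by (simp add: distrib_left distrib_right gr_scale_times times_gr_scale mult.assoc)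
    finally have "p (?A * (gr_abs t * ?R)) \<le>
        p (gr_scale (complex_of_real \<alpha>) (prod_list (as @ [a]) * ?R)
        + gr_scale (complex_of_real \<beta>) (prod_list (as @ [b]) * ?R))"
      by (rule unconditional_majorised[OF p(2)])
    also have "\<dots> \<le> \<alpha> * p (prod_list (as @ [a]) * ?R) + \<beta> * p (prod_list (as @ [b]) * ?R)"
      using seminorm_triangle[OF p(1), of "gr_scale (complex_of_real \<alpha>) (prod_list (as @ [a]) * ?R)"
          "gr_scale (complex_of_real \<beta>) (prod_list (as @ [b]) * ?R)"] ab(3,4)
      by (simp add: seminorm_scale[OF p(1)])
    also have "\<dots> \<le> \<alpha> * (\<theta> ^ length ts * M) + \<beta> * (\<theta> ^ length ts * M)"
      using Cons.IH[of "as @ [a]"] Cons.IH[of "as @ [b]"] Cons.prems ab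
      by (intro add_mono mult_left_mono) auto
    also have "\<dots> = \<theta> ^ length (t # ts) * M"
      using ab(5) by (simp add: distrib_right[symmetric])
    finally show ?case by simp
  qed
  from this[of "[]"] show ?thesis by simp
qed

section \<open>Summability over a conjugacy class\<close>

text \<open>
  Writing \<open>\<theta> ^ k\<close> as the square of \<open>sqrt \<theta> ^ k\<close> leaves one factor for \<open>Suc k\<close> and one for the
  polynomial of lower degree.
\<close>

lemma polynomial_times_geometric_bounded:
  fixes \<theta> :: real
  assumes "0 \<le> \<theta>" and "\<theta> < 1"
  shows "\<exists>C. \<forall>k. real (Suc k) ^ j * \<theta> ^ k \<le> C"
  using assms
proof (induction j arbitrary: \<theta>)
  case 0
  then show ?case by (auto intro!: exI[of _ 1] power_le_one)
next
  case (Suc j)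
  define \<psi> where "\<psi> = sqrt \<theta>"
  have \<psi>: "0 \<le> \<psi>" "\<psi> < 1" "\<theta> = \<psi> * \<psi>"
    using Suc.prems by (auto simp: \<psi>_def)
  obtain C where C: "\<And>k. real (Suc k) ^ j * \<psi> ^ k \<le> C"
    using Suc.IH[OF \<psi>(1,2)] by blast
  have "(\<lambda>k. real k * \<psi> ^ k + \<psi> ^ k) \<longlonglongrightarrow> 0 + 0"
    using \<psi> by (intro tendsto_add powser_times_n_limit_0 LIMSEQ_power_zero) simp_all
  then have "Bseq (\<lambda>k. real k * \<psi> ^ k + \<psi> ^ k)"
    by (intro convergent_imp_Bseq convergentI)
  then obtain D where D: "\<And>k. norm (real k * \<psi> ^ k + \<psi> ^ k) \<le> D"
    unfolding Bseq_def by blast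
  have "real (Suc k) ^ Suc j * \<theta> ^ k \<le> D * C" for k
  proof -
    have "real (Suc k) * \<psi> ^ k \<le> D"
      using D[of k] by (simp add: distrib_right)
    moreover have "0 \<le> D" using D[of k] norm_ge_zero order_trans by blast
    ultimately have "(real (Suc k) * \<psi> ^ k) * (real (Suc k) ^ j * \<psi> ^ k) \<le> D * C"
      using C[of k] \<psi>(1) by (intro mult_mono) auto
    then show ?thesis by (simp add: \<psi>(3) power_mult_distrib mult_ac)
  qed
  then show ?case by blast
qed

context unconditional_completion
begin

context
  fixes U :: "'a set" and S :: "'g set" and n :: nat
  assumes U: "open_unit_ball U" and abs: "\<And>a. \<iota> a \<in> U \<Longrightarrow> \<iota> (gr_abs a) \<in> U"
    and gen: "fin_sym_generating_set S" and n: "1 \<le> n"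
begin

abbreviation "T \<equiv> T_set scaleC \<iota> S U n"

interpretation S: fin_generated S
  by (unfold_locales) (rule gen)

lemma T_keys: "t \<in> T \<Longrightarrow> Poly_Mapping.keys t \<subseteq> {g. word_length S g \<le> n}"
  by (auto simp: T_set_def)

lemma T_scale: "t \<in> T \<Longrightarrow> \<iota> t \<in> scaleC (complex_of_real (real n / real (n + 1))) ` U"
  by (simp add: T_set_def)

lemma monom_in_T:
  assumes g: "word_length S g \<le> n"
  shows "\<exists>e>0. gr_monom g (complex_of_real e) \<in> T"
proof -
  let ?\<mu> = "real n / real (n + 1)"
  have \<mu>: "?\<mu> \<noteq> 0" using n by simp
  obtain e where e: "0 < e" "\<iota> (gr_scale (complex_of_real e) (gr_monom g (complex_of_real (1 / ?\<mu>)))) \<in> U"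
    using scaled_into_nbhd[of U "{gr_monom g (complex_of_real (1 / ?\<mu>))}"] U
    by (auto simp: open_unit_ball_def)
  let ?u = "gr_scale (complex_of_real e) (gr_monom g (complex_of_real (1 / ?\<mu>)))"
  have "gr_scale (complex_of_real ?\<mu>) ?u = gr_monom g (complex_of_real (?\<mu> * (e * (1 / ?\<mu>))))"
    by (simp only: gr_scale_monom of_real_mult)
  also have "?\<mu> * (e * (1 / ?\<mu>)) = e" using \<mu> by (metis mult.commute mult.right_neutral nonzero_mult_div_cancel_left times_divide_eq_right)
  finally have "\<iota> (gr_monom g (complex_of_real e)) = scaleC (complex_of_real ?\<mu>) (\<iota> ?u)"
    by (simp only: \<iota>.scale[symmetric])
  with e g show ?thesis
    by (intro exI[of _ e]) (auto simp: T_set_def lookup_single when_def in_keys_iff split: if_splits)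
qed

lemma T_generates: "\<exists>r. generated_bound T a r"
proof (rule generated_bound_exists)
  have "scaleC (complex_of_real (real n / real (n + 1))) 0 = \<iota> 0" "0 \<in> U"
    using U by (simp_all add: \<iota>.zero open_unit_ball_def)
  then show "0 \<in> T" by (auto simp: T_set_def intro: rev_image_eqI)
next
  have single: "\<exists>r. generated_bound T (gr_monom g 1) r" if g: "word_length S g \<le> n" for g
  proof -
    obtain e where e: "0 < e" "gr_monom g (complex_of_real e) \<in> T"
      using monom_in_T[OF g] by blast
    from generated_bound.scale[OF generated_bound.gen[OF e(2)], of "complex_of_real (1 / e)"] e(1)
    show ?thesis by (auto simp: gr_scale_monom)
  qed
  fix g
  obtain ws where ws: "set ws \<subseteq> S" "sum_list ws = g"
    by (rule S.word_length_word)
  have "\<exists>r. generated_bound T (gr_monom (sum_list ws) 1) r"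
    using ws(1)
  proof (induction ws)
    case Nil
    then show ?case using single[of 0] by simp
  next
    case (Cons s ws)
    have "word_length S s \<le> n"
      using S.word_length_le[of "[s]"] Cons.prems n by simp
    then obtain r r' where "generated_bound T (gr_monom s 1) r"
        "generated_bound T (gr_monom (sum_list ws) 1) r'"
      using single[of s] Cons by auto
    from generated_bound.times[OF this] show ?case by (auto simp: mult_single)
  qed
  then show "\<exists>r. generated_bound T (gr_monom g 1) r" by (simp add: ws(2))
qed

lemma norm_n_eq_gauge: "norm_n scaleC \<iota> S U n = gauge_seminorm T"
  using Greatest_bounding_seminorm[OF T_generates]
  unfolding norm_n_def bounding_seminorm_def .

lemma norm_n_seminorm: "seminorm gr_scale (norm_n scaleC \<iota> S U n)"
  using bounding_gauge_seminorm[OF T_generates]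
  by (simp add: norm_n_eq_gauge bounding_seminorm_def)

lemma seminorm_le_norm_n:
  assumes "seminorm gr_scale p" and "unconditional p"
    and "\<And>ts. set ts \<subseteq> T \<Longrightarrow> p (prod_list (map gr_abs ts)) \<le> C"
  shows "p a \<le> C * norm_n scaleC \<iota> S U n a"
  unfolding norm_n_eq_gauge by (rule seminorm_le_gauge_seminorm[OF assms T_generates])

lemma T_decay:
  assumes "finite G" and "\<iota> ` G \<subseteq> U" and "\<And>a. a \<in> G \<Longrightarrow> nonneg_coefs a"
  shows "\<exists>F. finite F \<and> G \<subseteq> F \<and> \<iota> ` F \<subseteq> U \<and>
    (\<forall>p M ts. seminorm gr_scale p \<longrightarrow> unconditional p \<longrightarrow>
      (\<forall>as. set as \<subseteq> F \<longrightarrow> p (prod_list as) \<le> M) \<longrightarrow> set ts \<subseteq> T \<longrightarrow>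
      p (prod_list (map gr_abs ts)) \<le> ((2 * real n + 1) / (2 * real n + 2)) ^ length ts * M)"
proof -
  let ?\<theta> = "(2 * real n + 1) / (2 * real n + 2)"
  obtain F where F: "finite F" "\<iota> ` F \<subseteq> U" "\<forall>a\<in>F. nonneg_coefs a" and
    major: "\<forall>t. Poly_Mapping.keys t \<subseteq> {g. word_length S g \<le> n} \<longrightarrow>
       \<iota> t \<in> scaleC (complex_of_real (real n / real (n + 1))) ` U \<longrightarrow>
       (\<exists>a\<in>F. \<exists>b\<in>F. \<exists>\<alpha>\<ge>0. \<exists>\<beta>\<ge>0. \<alpha> + \<beta> = ?\<theta> \<and>
         majorised t (gr_scale (complex_of_real \<alpha>) a + gr_scale (complex_of_real \<beta>) b))"
    using finite_majorants[OF U abs S.finite_ball[of n] n] by blast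
  have T: "\<exists>a\<in>F \<union> G. \<exists>b\<in>F \<union> G. \<exists>\<alpha>\<ge>0. \<exists>\<beta>\<ge>0. \<alpha> + \<beta> = ?\<theta> \<and>
         majorised t (gr_scale (complex_of_real \<alpha>) a + gr_scale (complex_of_real \<beta>) b)"
    if "t \<in> T" for t
    using major T_keys[OF that] T_scale[OF that] by blast
  have "p (prod_list (map gr_abs ts)) \<le> ?\<theta> ^ length ts * M"
    if "seminorm gr_scale p" "unconditional p"
      "\<forall>as. set as \<subseteq> F \<union> G \<longrightarrow> p (prod_list as) \<le> M" "set ts \<subseteq> T" for p M ts
  proof (rule word_decay[OF that(1,2) _ _ _ T that(4)])
    show "0 \<le> ?\<theta>" by simp
  qed (use that F assms in auto)
  then show ?thesis
    using F assms by (intro exI[of _ "F \<union> G"]) auto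
qed

lemma q_le_norm_n: "\<exists>C. \<forall>a. q k (\<iota> a) \<le> C * norm_n scaleC \<iota> S U n a"
proof -
  let ?\<theta> = "(2 * real n + 1) / (2 * real n + 2)"
  obtain F where F: "finite F" "\<iota> ` F \<subseteq> U" and
    decay: "\<And>p M ts. seminorm gr_scale p \<Longrightarrow> unconditional p \<Longrightarrow>
      \<forall>as. set as \<subseteq> F \<longrightarrow> p (prod_list as) \<le> M \<Longrightarrow> set ts \<subseteq> T \<Longrightarrow>
      p (prod_list (map gr_abs ts)) \<le> ?\<theta> ^ length ts * M"
    using T_decay[of "{}"] by auto
  obtain M where M: "\<forall>as. set as \<subseteq> F \<longrightarrow> (q k \<circ> \<iota>) (prod_list as) \<le> M"
    using words_bounded[OF U F, of k] by auto
  have "0 \<le> M" using M[rule_format, of "[]"] q_nonneg[of k] by (auto intro: order_trans)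
  have "(q k \<circ> \<iota>) (prod_list (map gr_abs ts)) \<le> M" if "set ts \<subseteq> T" for ts
  proof -
    have "?\<theta> ^ length ts * M \<le> 1 * M"
      using \<open>0 \<le> M\<close> by (intro mult_right_mono power_le_one) auto
    with decay[OF q_\<iota>_seminorm q_unconditional M that] show ?thesis by simp
  qed
  from seminorm_le_norm_n[OF q_\<iota>_seminorm q_unconditional this] show ?thesis by auto
qed

text \<open>
  For a product of \<open>k\<close> factors in \<open>T\<close>, the mass on the conjugacy class is moved by rotations into
  a ball of radius \<open>O(log k)\<close>, which has polynomially many elements. A coefficient at \<open>g\<close> is a
  coefficient at \<open>0\<close> after multiplication by the monomial of \<open>- g\<close>, and small multiples of the
  generators lie in \<open>U\<close>; so it exceeds the bound for the coefficient at \<open>0\<close> at most by a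
  factor exponential in the length of \<open>g\<close>, again polynomial in \<open>k\<close>. Both are beaten by the
  exponential decay.
\<close>

lemma conjugacy_mass_bounded:
  assumes "word_hyperbolic TYPE('g)"
  shows "\<exists>C. \<forall>ts G. set ts \<subseteq> T \<longrightarrow> finite G \<longrightarrow> G \<subseteq> conjugacy_class x \<longrightarrow>
    (\<Sum>g\<in>G. cmod (coef (prod_list (map gr_abs ts)) g)) \<le> C"
proof -
  let ?\<theta> = "(2 * real n + 1) / (2 * real n + 2)"
  obtain S' :: "'g set" and \<delta> where S': "fin_sym_generating_set S'" "0 \<le> \<delta>"
    "\<And>w x y z. gromov_product (word_metric S') w x z \<ge>
       min (gromov_product (word_metric S') w x y) (gromov_product (word_metric S') w y z) - \<delta>"
    using assms unfolding word_hyperbolic_def gromov_hyperbolic_def by blast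
  interpret H: hyperbolic_group S' \<delta>
    by unfold_locales (fact S')+
  \<comment> \<open>\<open>S\<close> and the generating set of the hyperbolic metric may differ; letters stay bounded.\<close>
  obtain l where l: "\<And>g. word_length S g \<le> n \<Longrightarrow> word_length S' g \<le> l"
  proof
    fix g assume "word_length S g \<le> n"
    then show "word_length S' g \<le> Max (word_length S' ` {g. word_length S g \<le> n})"
      using S.finite_ball by (intro Max_ge) auto
  qed
  obtain e where e: "0 < e" "e \<le> 1" and
    e_U: "\<And>a. a \<in> (\<lambda>s. gr_monom s 1) ` S' \<Longrightarrow> \<iota> (gr_scale (complex_of_real e) a) \<in> U"
    using scaled_into_nbhd[of U "(\<lambda>s. gr_monom s 1) ` S'"] U H.finite_S
    unfolding open_unit_ball_def by blast
  define u where "u s = gr_monom s (complex_of_real e)" for s :: 'g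
  have "\<iota> (u s) \<in> U" if "s \<in> S'" for s
    using e_U[of "gr_monom s 1"] that by (simp add: u_def gr_scale_monom)
  then have "finite (u ` S')" "\<iota> ` u ` S' \<subseteq> U" "\<And>a. a \<in> u ` S' \<Longrightarrow> nonneg_coefs a"
    using H.finite_S e(1) by (auto simp: u_def intro: nonneg_monom)
  from T_decay[OF this] obtain F where F: "finite F" "u ` S' \<subseteq> F" "\<iota> ` F \<subseteq> U" and
    decay: "\<And>p M ts. seminorm gr_scale p \<Longrightarrow> unconditional p \<Longrightarrow>
      \<forall>as. set as \<subseteq> F \<longrightarrow> p (prod_list as) \<le> M \<Longrightarrow> set ts \<subseteq> T \<Longrightarrow>
      p (prod_list (map gr_abs ts)) \<le> ?\<theta> ^ length ts * M"
    by blast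
  obtain M where M: "\<And>as. set as \<subseteq> F \<Longrightarrow> cmod (coef (prod_list as) 0) \<le> M"
    using word_coefs_bounded[OF U F(1,3)] by blast
  have M0: "0 \<le> M" using M[of "[]"] norm_ge_zero by (auto intro: order_trans)
  have word_u: "prod_list (map u ws) = gr_monom (sum_list ws) (complex_of_real (e ^ length ws))" for ws
    by (induction ws) (simp_all add: u_def mult_single)
  have coef_F: "cmod (coef (prod_list as) g) \<le> M / e ^ R"
    if "set as \<subseteq> F" "word_length S' g \<le> R" for as g R
  proof -
    obtain ws where ws: "length ws = word_length S' (- g)" "set ws \<subseteq> S'" "sum_list ws = - g"
      by (rule H.word_length_word)
    have "set (map u ws @ as) \<subseteq> F" using ws(2) that(1) F(2) by auto
    from M[OF this] have "e ^ length ws * cmod (coef (prod_list as) g) \<le> M"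
      using e(1) by (simp add: word_u ws(3) coef_monom_times norm_mult norm_power)
    moreover have "e ^ R \<le> e ^ length ws"
      using e ws(1) that(2) by (intro power_decreasing) auto
    ultimately have "e ^ R * cmod (coef (prod_list as) g) \<le> M"
      by (meson mult_right_mono norm_ge_zero order_trans)
    then show ?thesis using e(1) by (simp add: field_simps)
  qed
  have coef_T: "cmod (coef (prod_list (map gr_abs ts)) g) \<le> ?\<theta> ^ length ts * (M / e ^ R)"
    if "set ts \<subseteq> T" "word_length S' g \<le> R" for ts g R
    using decay[OF seminorm_sum_coefs unconditional_sum_coefs _ that(1), of "{g}" "M / e ^ R"]
      coef_F[OF _ that(2)]
    by simp
  define r0 where "r0 = nat \<lceil>7 * real (word_length S' x) + 8 * \<delta> + 2 + 2 * real l\<rceil>"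
  define r1 where "r1 = nat \<lceil>2 * \<delta>\<rceil>"
  define E where "E = (real (card S') + 1) / e"
  have E: "1 \<le> E" using e by (simp add: E_def field_simps)
  obtain j :: nat where j: "E ^ r1 < 2 ^ j"
    using real_arch_pow[of 2 "E ^ r1"] by auto
  obtain C where C: "\<And>k. real (Suc k) ^ Suc j * ?\<theta> ^ k \<le> C"
    using polynomial_times_geometric_bounded[of ?\<theta> "Suc j"] by (auto simp: field_simps)
  have bound: "(\<Sum>g\<in>G. cmod (coef (prod_list (map gr_abs ts)) g)) \<le> M * E ^ r0 * 2 ^ j * C"
    if ts: "set ts \<subseteq> T" and G: "finite G" "G \<subseteq> conjugacy_class x" for ts G
  proof -
    define k where "k = length ts"
    obtain m where m: "2 ^ m \<le> Suc k" "Suc k < 2 ^ (m + 1)"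
      using ex_power_ivl1[of 2 "Suc k"] by auto
    define R where "R = r0 + Suc m * r1"
    let ?B = "{g. word_length S' g \<le> R}"
    have "(\<Sum>g\<in>G. cmod (coef (prod_list (map gr_abs ts)) g)) \<le>
      (\<Sum>i\<le>length (map gr_abs ts). \<Sum>g\<in>?B. cmod (coef (prod_list (rotation i (map gr_abs ts))) g))"
    proof (rule sum_coefs_le_rotations[OF _ G(1) H.finite_ball])
      fix gs assume gs: "gs \<in> support_words (map gr_abs ts)" "sum_list gs \<in> G"
      have len: "length gs = k"
        using gs(1) by (auto simp: support_words_def k_def dest: list_all2_lengthD)
      have letters: "real (word_length S' g) \<le> real l" if g: "g \<in> set gs" for g
      proof -
        obtain i where "i < length ts" "g = gs ! i"
          using g len by (auto simp: in_set_conv_nth k_def)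
        moreover from this have "gs ! i \<in> Poly_Mapping.keys (gr_abs (ts ! i))"
          using gs(1) by (auto simp: support_words_def list_all2_conv_all_nth)
        ultimately have "g \<in> Poly_Mapping.keys (ts ! i)" "ts ! i \<in> T"
          using ts by (auto simp: in_keys_iff)
        then show ?thesis using T_keys l by auto
      qed
      have "sum_list gs \<in> conjugacy_class x" "length gs \<le> 2 ^ Suc m" "0 \<le> real l"
        using gs(2) G(2) m len by auto
      from H.short_rotation[OF this(1,2) letters this(3)] obtain i where
        i: "i \<le> k" "real (word_length S' (sum_list (rotation i gs)))
          \<le> 7 * real (word_length S' x) + 8 * \<delta> + 2 + 2 * real l + 2 * real (Suc m) * \<delta>"
        unfolding len by blast
      have "7 * real (word_length S' x) + 8 * \<delta> + 2 + 2 * real l \<le> real r0"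
        unfolding r0_def by (rule real_nat_ceiling_ge)
      moreover have "real (Suc m) * (2 * \<delta>) \<le> real (Suc m) * real r1"
        unfolding r1_def by (intro mult_left_mono real_nat_ceiling_ge) simp
      then have "2 * real (Suc m) * \<delta> \<le> real (Suc m * r1)"
        by (simp only: of_nat_mult mult.assoc mult.left_commute)
      ultimately have "real (word_length S' (sum_list (rotation i gs))) \<le> real R"
        using i(2) unfolding R_def of_nat_add by linarith
      then show "\<exists>i\<le>length (map gr_abs ts). sum_list (rotation i gs) \<in> ?B"
        using i(1) by (intro exI[of _ i]) (simp add: k_def)
    qed auto
    also have "\<dots> \<le> (\<Sum>i\<le>k. \<Sum>g\<in>?B. ?\<theta> ^ k * (M / e ^ R))"
    proof -
      have "cmod (coef (prod_list (rotation i (map gr_abs ts))) g) \<le> ?\<theta> ^ k * (M / e ^ R)"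
        if "i \<le> k" "g \<in> ?B" for i g
      proof -
        have "set (rotation i ts) \<subseteq> T" "length (rotation i ts) = k"
          using ts that(1) by (auto simp: k_def dest: in_set_dropD in_set_takeD)
        moreover have "rotation i (map gr_abs ts) = map gr_abs (rotation i ts)"
          by (simp add: drop_map take_map)
        ultimately show ?thesis
          using coef_T[of "rotation i ts" g R] that(2) by simp
      qed
      then show ?thesis unfolding length_map k_def[symmetric] by (intro sum_mono) auto
    qed
    also have "\<dots> = real (Suc k) * (real (card ?B) * (?\<theta> ^ k * (M / e ^ R)))"
      by simp
    also have "\<dots> \<le> real (Suc k) * ((real (card S') + 1) ^ R * (?\<theta> ^ k * (M / e ^ R)))"
    proof -
      have "real (card ?B) \<le> (real (card S') + 1) ^ R"
        using H.card_ball[of R] by (metis of_nat_1 of_nat_add of_nat_le_iff of_nat_power)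
      then show ?thesis using M0 e(1) by (intro mult_left_mono mult_right_mono) auto
    qed
    also have "\<dots> = M * (real (Suc k) * ?\<theta> ^ k) * E ^ R"
      using e(1) by (simp add: E_def power_divide)
    also have "\<dots> \<le> M * (real (Suc k) * ?\<theta> ^ k) * (E ^ r0 * (2 ^ j * real (Suc k) ^ j))"
    proof -
      \<comment> \<open>\<open>2 ^ Suc m \<le> 2 * Suc k\<close> turns the exponential in the radius into a power of \<open>k\<close>.\<close>
      have "(E ^ r1) ^ Suc m \<le> (2 ^ j) ^ Suc m"
        using j E by (intro power_mono) auto
      also have "\<dots> = (2 ^ Suc m) ^ j"
        by (simp only: power_mult[symmetric] mult.commute)
      also have "\<dots> \<le> (2 * real (Suc k)) ^ j"
      proof (rule power_mono)
        have "real (2 ^ m) \<le> real (Suc k)" using m(1) by (simp only: of_nat_le_iff)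
        then show "2 ^ Suc m \<le> 2 * real (Suc k)" by simp
      qed simp
      finally have "(E ^ r1) ^ Suc m \<le> 2 ^ j * real (Suc k) ^ j"
        by (simp only: power_mult_distrib)
      moreover have "E ^ R = E ^ r0 * (E ^ r1) ^ Suc m"
        unfolding R_def power_add by (simp only: power_mult[symmetric] mult.commute)
      ultimately have "E ^ R \<le> E ^ r0 * (2 ^ j * real (Suc k) ^ j)"
        using E by (simp only:) (intro mult_left_mono, auto)
      then show ?thesis using M0 by (intro mult_left_mono) auto
    qed
    also have "\<dots> = M * E ^ r0 * 2 ^ j * (real (Suc k) ^ Suc j * ?\<theta> ^ k)"
      by (simp only: power_Suc mult_ac)
    also have "\<dots> \<le> M * E ^ r0 * 2 ^ j * C"
      using C M0 E by (intro mult_left_mono) auto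
    finally show ?thesis .
  qed
  then show ?thesis by blast
qed

lemma conjugacy_mass_le_norm_n:
  assumes "word_hyperbolic TYPE('g)"
  shows "\<exists>C. \<forall>G a. finite G \<longrightarrow> G \<subseteq> conjugacy_class x \<longrightarrow>
    (\<Sum>g\<in>G. cmod (coef a g)) \<le> C * norm_n scaleC \<iota> S U n a"
proof -
  obtain C where "\<And>ts G. set ts \<subseteq> T \<Longrightarrow> finite G \<Longrightarrow> G \<subseteq> conjugacy_class x \<Longrightarrow>
      (\<Sum>g\<in>G. cmod (coef (prod_list (map gr_abs ts)) g)) \<le> C"
    using conjugacy_mass_bounded[OF assms] by blast
  then show ?thesis
    using seminorm_le_norm_n[OF seminorm_sum_coefs unconditional_sum_coefs] by blast
qed

end

section \<open>Passage to the completions\<close>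

lemma tendsto_\<iota>_diff:
  assumes "(\<lambda>i. \<iota> (f i)) \<longlonglongrightarrow> a" and "\<And>k. (\<lambda>i. q k (\<iota> (h i - f i))) \<longlonglongrightarrow> 0"
  shows "(\<lambda>i. \<iota> (h i)) \<longlonglongrightarrow> a"
  unfolding tendsto_q_iff
proof
  fix k
  have "(\<lambda>i. q k (\<iota> (h i - f i)) + q k (\<iota> (f i) - a)) \<longlonglongrightarrow> 0"
    using assms(1) unfolding tendsto_q_iff by (intro tendsto_add_zero assms(2)) blast
  moreover have "q k (\<iota> (h i) - a) \<le> q k (\<iota> (h i - f i)) + q k (\<iota> (f i) - a)" for i
    using q_triangle[of k "\<iota> (h i - f i)" "\<iota> (f i) - a"] by (simp add: \<iota>.diff)
  ultimately show "(\<lambda>i. q k (\<iota> (h i) - a)) \<longlonglongrightarrow> 0"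
    by (elim Lim_null_comparison[rotated]) (simp add: q_nonneg)
qed

text \<open>
  A representative of a class in the completion approximates its image in the algebra and
  computes its norm, because the seminorms of the algebra are bounded by \<open>N\<close>.
\<close>

lemma completion_representative:
  assumes N: "seminorm gr_scale N" and le: "\<And>k. \<exists>C. \<forall>a. q k (\<iota> a) \<le> C * N a"
    and X: "X \<in> completion N"
  shows "\<exists>f. (\<lambda>i. \<iota> (f i)) \<longlonglongrightarrow> extend_to_completion \<iota> X \<and>
    (\<lambda>i. N (f i)) \<longlonglongrightarrow> completion_norm N X"
proof -
  define rel where "rel = {(f, h). f \<in> cauchy_seqs N \<and> h \<in> cauchy_seqs N \<and> (\<lambda>i. N (f i - h i)) \<longlonglongrightarrow> 0}"
  obtain f where f: "X = rel `` {f}" "f \<in> cauchy_seqs N"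
    using X unfolding completion_def rel_def[symmetric] by (rule quotientE)
  have X_iff: "h \<in> X \<longleftrightarrow> h \<in> cauchy_seqs N \<and> (\<lambda>i. N (f i - h i)) \<longlonglongrightarrow> 0" for h
    using f by (auto simp: rel_def)
  have fX: "f \<in> X" using f(2) by (simp add: X_iff seminorm_zero[OF N])
  have cauchy: "\<exists>M. \<forall>i\<ge>M. \<forall>j\<ge>M. N (f i - f j) < \<epsilon>" if "0 < \<epsilon>" for \<epsilon>
    using f(2) that by (simp add: cauchy_seqs_def)
  have pos_le: "\<exists>C>0. \<forall>a. q k (\<iota> a) \<le> C * N a" for k
  proof -
    obtain C where C: "\<And>a. q k (\<iota> a) \<le> C * N a" using le by blast
    have "q k (\<iota> a) \<le> (\<bar>C\<bar> + 1) * N a" for a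
    proof -
      have "C * N a \<le> (\<bar>C\<bar> + 1) * N a"
        using seminorm_nonneg[OF N] by (intro mult_right_mono) auto
      then show ?thesis using C order_trans by blast
    qed
    then show ?thesis by (intro exI[of _ "\<bar>C\<bar> + 1"]) auto
  qed
  have "\<exists>a. (\<lambda>i. \<iota> (f i)) \<longlonglongrightarrow> a"
  proof (rule q_cauchy_converges)
    fix k and \<epsilon> :: real assume "0 < \<epsilon>"
    obtain C where C: "0 < C" "\<And>a. q k (\<iota> a) \<le> C * N a" using pos_le by blast
    then obtain M where "\<forall>i\<ge>M. \<forall>j\<ge>M. N (f i - f j) < \<epsilon> / C"
      using cauchy[of "\<epsilon> / C"] \<open>0 < \<epsilon>\<close> by auto
    then have "\<forall>i\<ge>M. \<forall>j\<ge>M. C * N (f i - f j) < \<epsilon>"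
      using C(1) by (simp add: field_simps)
    then have "\<forall>i\<ge>M. \<forall>j\<ge>M. q k (\<iota> (f i - f j)) < \<epsilon>"
      using C(2) by (blast intro: order.strict_trans1)
    then show "\<exists>M. \<forall>i\<ge>M. \<forall>j\<ge>M. q k (\<iota> (f i) - \<iota> (f j)) < \<epsilon>"
      by (auto simp: \<iota>.diff)
  qed
  then obtain a where a: "(\<lambda>i. \<iota> (f i)) \<longlonglongrightarrow> a" by blast
  have all_a: "\<forall>h\<in>X. (\<lambda>i. \<iota> (h i)) \<longlonglongrightarrow> a"
  proof
    fix h assume h: "h \<in> X"
    show "(\<lambda>i. \<iota> (h i)) \<longlonglongrightarrow> a"
    proof (rule tendsto_\<iota>_diff[OF a])
      fix k
      obtain C where C: "\<And>a. q k (\<iota> a) \<le> C * N a" using le by blast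
      have "(\<lambda>i. C * N (f i - h i)) \<longlonglongrightarrow> 0"
        using h by (intro tendsto_mult_right_zero) (simp add: X_iff)
      moreover have "q k (\<iota> (h i - f i)) \<le> C * N (f i - h i)" for i
        using C[of "h i - f i"] by (simp add: seminorm_minus_commute[OF N, of "f i"])
      ultimately show "(\<lambda>i. q k (\<iota> (h i - f i))) \<longlonglongrightarrow> 0"
        by (elim Lim_null_comparison[rotated]) (simp add: q_nonneg)
    qed
  qed
  have "extend_to_completion \<iota> X = a"
    unfolding extend_to_completion_def
    by (rule the_equality, fact all_a) (use fX a LIMSEQ_unique in blast)
  moreover have "Cauchy (\<lambda>i. N (f i))"
    unfolding Cauchy_def dist_real_def
    using cauchy seminorm_diff_le[OF N] by (meson order.strict_trans1)
  then obtain r where r: "(\<lambda>i. N (f i)) \<longlonglongrightarrow> r"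
    using Cauchy_convergent_iff convergent_def by blast
  have all_r: "\<forall>h\<in>X. (\<lambda>i. N (h i)) \<longlonglongrightarrow> r"
  proof
    fix h assume "h \<in> X"
    then have "(\<lambda>i. N (f i - h i)) \<longlonglongrightarrow> 0" by (simp add: X_iff)
    then have "(\<lambda>i. N (f i) - N (h i)) \<longlonglongrightarrow> 0"
      by (rule Lim_null_comparison[rotated]) (simp add: seminorm_diff_le[OF N])
    from tendsto_diff[OF r this] show "(\<lambda>i. N (h i)) \<longlonglongrightarrow> r" by simp
  qed
  have "completion_norm N X = r"
    unfolding completion_norm_def
    by (rule the_equality, fact all_r) (use fX r LIMSEQ_unique in blast)
  ultimately show ?thesis using a r by blast
qed

text \<open>
  Coefficients are continuous on the group ring, so they extend to limits of sequences from the
  group ring; elements that are not such limits get an arbitrary value.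
\<close>

definition lim_coef :: "'a \<Rightarrow> 'g \<Rightarrow> complex" where
  "lim_coef a g = (THE z. \<forall>f. (\<lambda>i. \<iota> (f i)) \<longlonglongrightarrow> a \<longrightarrow> (\<lambda>i. coef (f i) g) \<longlonglongrightarrow> z)"

lemma coef_tendsto_lim_coef:
  assumes f: "(\<lambda>i. \<iota> (f i)) \<longlonglongrightarrow> a"
  shows "(\<lambda>i. coef (f i) g) \<longlonglongrightarrow> lim_coef a g"
proof -
  obtain k C where C: "0 < C" "\<And>a. cmod (coef a g) \<le> C * q k (\<iota> a)"
    using cmod_coef_le_q by blast
  have diff: "cmod (coef (h i) g - coef (h' j) g) \<le> C * q k (\<iota> (h i) - a) + C * q k (\<iota> (h' j) - a)"
    for h h' :: "nat \<Rightarrow> 'g \<Rightarrow>\<^sub>0 complex" and i j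
  proof -
    have "cmod (coef (h i) g - coef (h' j) g) \<le> C * q k (\<iota> (h i - h' j))"
      using C(2)[of "h i - h' j"] by (simp add: lookup_minus)
    also have "q k (\<iota> (h i - h' j)) \<le> q k (\<iota> (h i) - a) + q k (\<iota> (h' j) - a)"
      using q_triangle[of k "\<iota> (h i) - a" "a - \<iota> (h' j)"]
      by (simp add: \<iota>.diff q_minus_commute[of k a])
    finally show ?thesis using C(1) by (simp add: distrib_left)
  qed
  have null: "(\<lambda>i. C * q k (\<iota> (h i) - a)) \<longlonglongrightarrow> 0" if "(\<lambda>i. \<iota> (h i)) \<longlonglongrightarrow> a" for h
    using that unfolding tendsto_q_iff by (intro tendsto_mult_right_zero) blast
  have "Cauchy (\<lambda>i. coef (f i) g)"
    unfolding Cauchy_def dist_norm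
  proof (intro allI impI)
    fix \<epsilon> :: real assume "0 < \<epsilon>"
    then obtain M where M: "\<And>i. M \<le> i \<Longrightarrow> C * q k (\<iota> (f i) - a) < \<epsilon> / 2"
      using order_tendstoD(2)[OF null[OF f], of "\<epsilon> / 2"] by (auto simp: eventually_sequentially)
    have "cmod (coef (f i) g - coef (f j) g) < \<epsilon>" if "M \<le> i" "M \<le> j" for i j
      using diff[of f i f j] M[OF that(1)] M[OF that(2)] by simp
    then show "\<exists>M. \<forall>i\<ge>M. \<forall>j\<ge>M. cmod (coef (f i) g - coef (f j) g) < \<epsilon>" by blast
  qed
  then obtain z where z: "(\<lambda>i. coef (f i) g) \<longlonglongrightarrow> z"
    using Cauchy_convergent_iff convergent_def by blast
  have all_z: "\<forall>h. (\<lambda>i. \<iota> (h i)) \<longlonglongrightarrow> a \<longrightarrow> (\<lambda>i. coef (h i) g) \<longlonglongrightarrow> z"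
  proof (intro allI impI)
    fix h assume h: "(\<lambda>i. \<iota> (h i)) \<longlonglongrightarrow> a"
    have "(\<lambda>i. C * q k (\<iota> (h i) - a) + C * q k (\<iota> (f i) - a)) \<longlonglongrightarrow> 0"
      using tendsto_add[OF null[OF h] null[OF f]] by simp
    then have "(\<lambda>i. coef (h i) g - coef (f i) g) \<longlonglongrightarrow> 0"
      by (rule Lim_null_comparison[rotated]) (simp add: diff)
    from tendsto_add[OF this z] show "(\<lambda>i. coef (h i) g) \<longlonglongrightarrow> z" by simp
  qed
  have "lim_coef a g = z"
    unfolding lim_coef_def by (rule the_equality, fact all_z) (use f z LIMSEQ_unique in blast)
  then show ?thesis using z by simp
qed

lemma lim_coef_\<iota>: "lim_coef (\<iota> a) g = coef a g"
proof -
  have "(\<lambda>i::nat. coef a g) \<longlonglongrightarrow> lim_coef (\<iota> a) g"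
    by (rule coef_tendsto_lim_coef[of "\<lambda>_. a"]) simp
  then show ?thesis by (simp add: LIMSEQ_const_iff)
qed

lemma lim_coef_add:
  assumes f: "(\<lambda>i. \<iota> (f i)) \<longlonglongrightarrow> a" and h: "(\<lambda>i. \<iota> (h i)) \<longlonglongrightarrow> b"
  shows "lim_coef (a + b) g = lim_coef a g + lim_coef b g"
proof -
  have "(\<lambda>i. \<iota> (f i + h i)) \<longlonglongrightarrow> a + b"
    unfolding tendsto_q_iff
  proof
    fix k
    have "(\<lambda>i. q k (\<iota> (f i) - a) + q k (\<iota> (h i) - b)) \<longlonglongrightarrow> 0"
      using f h unfolding tendsto_q_iff by (intro tendsto_add_zero) auto
    moreover have "q k (\<iota> (f i + h i) - (a + b)) \<le> q k (\<iota> (f i) - a) + q k (\<iota> (h i) - b)" for i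
      using q_triangle[of k "\<iota> (f i) - a" "\<iota> (h i) - b"] by (simp add: \<iota>.add algebra_simps)
    ultimately show "(\<lambda>i. q k (\<iota> (f i + h i) - (a + b))) \<longlonglongrightarrow> 0"
      by (elim Lim_null_comparison[rotated]) (simp add: q_nonneg)
  qed
  from coef_tendsto_lim_coef[OF this, of g]
  have "(\<lambda>i. coef (f i) g + coef (h i) g) \<longlonglongrightarrow> lim_coef (a + b) g"
    by (simp add: lookup_add)
  moreover have "(\<lambda>i. coef (f i) g + coef (h i) g) \<longlonglongrightarrow> lim_coef a g + lim_coef b g"
    by (intro tendsto_add coef_tendsto_lim_coef f h)
  ultimately show ?thesis by (rule LIMSEQ_unique)
qed

lemma lim_coef_scale:
  assumes f: "(\<lambda>i. \<iota> (f i)) \<longlonglongrightarrow> a"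
  shows "lim_coef (scaleC c a) g = c * lim_coef a g"
proof -
  have "(\<lambda>i. \<iota> (gr_scale c (f i))) \<longlonglongrightarrow> scaleC c a"
    unfolding tendsto_q_iff
  proof
    fix k
    have "(\<lambda>i. cmod c * q k (\<iota> (f i) - a)) \<longlonglongrightarrow> 0"
      using f unfolding tendsto_q_iff by (intro tendsto_mult_right_zero) blast
    then show "(\<lambda>i. q k (\<iota> (gr_scale c (f i)) - scaleC c a)) \<longlonglongrightarrow> 0"
      by (simp add: \<iota>.scale q_scale flip: \<iota>.vs2.scale_right_diff_distrib)
  qed
  from coef_tendsto_lim_coef[OF this, of g]
  have "(\<lambda>i. c * coef (f i) g) \<longlonglongrightarrow> lim_coef (scaleC c a) g" by simp
  moreover have "(\<lambda>i. c * coef (f i) g) \<longlonglongrightarrow> c * lim_coef a g"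
    by (intro tendsto_mult_left coef_tendsto_lim_coef f)
  ultimately show ?thesis by (rule LIMSEQ_unique)
qed

text \<open>Bounds for finite partial sums are closed conditions, so they pass to limits.\<close>

lemma lim_coef_summable:
  assumes f: "(\<lambda>i. \<iota> (f i)) \<longlonglongrightarrow> a" and r: "(\<lambda>i. N (f i)) \<longlonglongrightarrow> r"
    and le: "\<And>G b. finite G \<Longrightarrow> G \<subseteq> A \<Longrightarrow> (\<Sum>g\<in>G. cmod (coef b g)) \<le> C * N b"
  defines "m \<equiv> \<lambda>g. indicator A g * lim_coef a g"
  shows "m \<in> l1 \<and> l1_norm m \<le> C * r"
proof -
  have sums: "(\<Sum>g\<in>G. cmod (m g)) \<le> C * r" if "finite G" for G
  proof -
    have "(\<Sum>g\<in>G. cmod (m g)) = (\<Sum>g\<in>G \<inter> A. cmod (lim_coef a g))"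
      using that by (intro sum.mono_neutral_cong_right) (auto simp: m_def indicator_def)
    also have "\<dots> \<le> C * r"
    proof (rule LIMSEQ_le)
      show "(\<lambda>i. \<Sum>g\<in>G \<inter> A. cmod (coef (f i) g)) \<longlonglongrightarrow> (\<Sum>g\<in>G \<inter> A. cmod (lim_coef a g))"
        by (intro tendsto_intros coef_tendsto_lim_coef f)
      show "(\<lambda>i. C * N (f i)) \<longlonglongrightarrow> C * r"
        by (intro tendsto_intros r)
      show "\<exists>M. \<forall>i\<ge>M. (\<Sum>g\<in>G \<inter> A. cmod (coef (f i) g)) \<le> C * N (f i)"
        using le that by auto
    qed
    finally show ?thesis .
  qed
  have summable: "(\<lambda>g. cmod (m g)) summable_on UNIV"
    by (rule nonneg_bdd_above_summable_on) (auto intro!: bdd_aboveI2[of _ _ "C * r"] sums)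
  then show ?thesis
    using infsum_le_finite_sums[OF summable sums] by (simp add: l1_def l1_norm_def)
qed

end

theorem corollary6p3:
  fixes scaleC :: "complex \<Rightarrow> 'a::{ring_1,t2_space} \<Rightarrow> 'a"
    and \<iota> :: "('g::group_add \<Rightarrow>\<^sub>0 complex) \<Rightarrow> 'a"
    and S :: "'g set" and U :: "'a set" and x :: 'g
  assumes "word_hyperbolic TYPE('g)"
    and "unconditional_frechet_algebra scaleC \<iota>"
    and "admissible TYPE('a)"
    and "fin_sym_generating_set S"
    and "open_unit_ball U"
    and "\<And>a. \<iota> a \<in> U \<Longrightarrow> \<iota> (gr_abs a) \<in> U"
  shows "\<exists>m :: 'a \<Rightarrow> 'g \<Rightarrow> complex.
    (\<forall>a. m (\<iota> a) = (\<lambda>g. indicator (conjugacy_class x) g * Poly_Mapping.lookup a g)) \<and>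
    (\<forall>a\<in>A_omega scaleC \<iota> S U. \<forall>b\<in>A_omega scaleC \<iota> S U. m (a + b) = (\<lambda>g. m a g + m b g)) \<and>
    (\<forall>c. \<forall>a\<in>A_omega scaleC \<iota> S U. m (scaleC c a) = (\<lambda>g. c * m a g)) \<and>
    (\<forall>a\<in>A_omega scaleC \<iota> S U. m a \<in> l1) \<and>
    (\<forall>n\<ge>1. \<exists>C. \<forall>X\<in>A_n scaleC \<iota> S U n.
       l1_norm (m (extend_to_completion \<iota> X)) \<le> C * completion_norm (norm_n scaleC \<iota> S U n) X)"
proof -
  obtain q where q: "\<And>k. seminorm scaleC (q k)" "\<And>k. unconditional (q k \<circ> \<iota>)" "topology_given_by q"
    using assms(2) unfolding unconditional_frechet_algebra_def by blast
  interpret unconditional_completion scaleC \<iota> q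
    using assms(2) q unfolding unconditional_frechet_algebra_def frechet_algebra_def
    by (intro unconditional_completion.intro) auto
  define m where "m a g = indicator (conjugacy_class x) g * lim_coef a g" for a g
  have rep: "\<exists>f. (\<lambda>i. \<iota> (f i)) \<longlonglongrightarrow> extend_to_completion \<iota> X \<and>
      (\<lambda>i. norm_n scaleC \<iota> S U n (f i)) \<longlonglongrightarrow> completion_norm (norm_n scaleC \<iota> S U n) X"
    if "1 \<le> n" "X \<in> A_n scaleC \<iota> S U n" for n X
    using that unfolding A_n_def
    by (intro completion_representative norm_n_seminorm q_le_norm_n assms(4-6))
  have approx: "\<exists>f. (\<lambda>i. \<iota> (f i)) \<longlonglongrightarrow> a" if a: "a \<in> A_omega scaleC \<iota> S U" for a
  proof -
    obtain n X where "1 \<le> n" "X \<in> A_n scaleC \<iota> S U n" "a = extend_to_completion \<iota> X"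
      using a unfolding A_omega_def by auto
    then show ?thesis using rep by blast
  qed
  have bound: "\<exists>C. \<forall>X\<in>A_n scaleC \<iota> S U n. m (extend_to_completion \<iota> X) \<in> l1 \<and>
      l1_norm (m (extend_to_completion \<iota> X)) \<le> C * completion_norm (norm_n scaleC \<iota> S U n) X"
    if n: "1 \<le> n" for n
  proof -
    obtain C where "\<And>G a. finite G \<Longrightarrow> G \<subseteq> conjugacy_class x \<Longrightarrow>
        (\<Sum>g\<in>G. cmod (coef a g)) \<le> C * norm_n scaleC \<iota> S U n a"
      using conjugacy_mass_le_norm_n[OF assms(5,6,4) n assms(1)] by blast
    from lim_coef_summable[where A = "conjugacy_class x", OF _ _ this] have
      "m (extend_to_completion \<iota> X) \<in> l1 \<and>
        l1_norm (m (extend_to_completion \<iota> X)) \<le> C * completion_norm (norm_n scaleC \<iota> S U n) X"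
      if "X \<in> A_n scaleC \<iota> S U n" for X
      using rep[OF n that] unfolding m_def by blast
    then show ?thesis by blast
  qed
  show ?thesis
  proof (intro exI[of _ m] conjI allI ballI impI)
    fix a show "m (\<iota> a) = (\<lambda>g. indicator (conjugacy_class x) g * coef a g)"
      by (simp add: m_def lim_coef_\<iota> fun_eq_iff)
  next
    fix a b assume "a \<in> A_omega scaleC \<iota> S U" "b \<in> A_omega scaleC \<iota> S U"
    with approx obtain f h where "(\<lambda>i. \<iota> (f i)) \<longlonglongrightarrow> a" "(\<lambda>i. \<iota> (h i)) \<longlonglongrightarrow> b" by blast
    then show "m (a + b) = (\<lambda>g. m a g + m b g)"
      by (simp add: m_def lim_coef_add distrib_left fun_eq_iff)
  next
    fix c a assume "a \<in> A_omega scaleC \<iota> S U"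
    with approx obtain f where "(\<lambda>i. \<iota> (f i)) \<longlonglongrightarrow> a" by blast
    then show "m (scaleC c a) = (\<lambda>g. c * m a g)"
      by (simp add: m_def lim_coef_scale fun_eq_iff)
  next
    fix a assume "a \<in> A_omega scaleC \<iota> S U"
    then obtain n X where "1 \<le> n" "X \<in> A_n scaleC \<iota> S U n" "a = extend_to_completion \<iota> X"
      unfolding A_omega_def by auto
    then show "m a \<in> l1" using bound by blast
  next
    fix n :: nat assume "1 \<le> n"
    then show "\<exists>C. \<forall>X\<in>A_n scaleC \<iota> S U n.
       l1_norm (m (extend_to_completion \<iota> X)) \<le> C * completion_norm (norm_n scaleC \<iota> S U n) X"
      using bound by blast
  qed
qed

end
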